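(* Let $k\ge1$ be an integer. Every $v\in\mathcal U_0^{(2),k}(\Omega)$ can be decomposed as $v=\nabla\times w_1+w_2$ with $w_1\in\mathcal U^{(1),k}_{0,\mathrm{curl}}(\Omega)$ and $w_2\in\mathcal U^{(2),k}_{0,\mathrm{div}}(\Omega)$.
   Context: Finite pyramid: $\Omega=\{(\xi,\eta,\zeta)\in\mathbb R^3:\xi,\eta,\zeta\ge0,\ \xi\le1-\zeta,\ \eta\le1-\zeta\}$. Infinite pyramid: $\Omega_\infty=\{(x,y,z): 0\le x,y\le1,\ z\ge0\}$ (together with a point $\infty$). Map: $\phi:\Omega_\infty\to\Omega$, $\phi(x,y,z)=\left(\frac{x}{1+z},\frac{y}{1+z},\frac{z}{1+z}\right)$, a diffeomorphism onto $\Omega$ minus its apex $(0,0,1)$. Pullbacks: 1-forms $\phi^*E=D\phi^T(E\circ\phi)$; 2-forms $\phi^*v=|D\phi|D\phi^{-1}(v\circ\phi)$, $|D\phi|$ being the Jacobian determinant; $(\phi^{-1})^*=(\phi^* )^{-1}$. $Q^{l,m,n}$: polynomials of degree at most $l,m,n$ in $x,y,z$; $Q^{l,m,n}_k=\{u/(1+z)^k:u\in Q^{l,m,n}\}$; $P^n_k[w,z]=\{u(w,z)/(1+z)^k:u$ polynomial of total degree $\le n\}$. Polynomial spaces with a negative degree are $\{0\}$. Subscripts $x,y$ on $r,s,t$ denote partial derivatives. $\mathcal U^{(2),k}(\Omega_\infty)$: all $u\in Q_{k+2}^{k,k-1,k-2}\times Q_{k+2}^{k-1,k,k-2}\times Q_{k+2}^{k-1,k-1,k-1}\oplus\{\frac{z^{k-1}}{(1+z)^{k+2}}(0,2s,s_y(1+z))^T:s\in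 Q^{k-1,k}[x,y]\}\oplus\{\frac{z^{k-1}}{(1+z)^{k+2}}(2t,0,t_x(1+z))^T:t\in Q^{k,k-1}[x,y]\}$ whose normal components lie in $P^{k-1}_{k+2}[x,z]$ on $y=0,1$ and in $P^{k-1}_{k+2}[y,z]$ on $x=0,1$. $\mathcal U^{(2),k}(\Omega)=(\phi^{-1})^*\mathcal U^{(2),k}(\Omega_\infty)$ (2-form pullback), and $\mathcal U_0^{(2),k}(\Omega)$ is the subspace of fields with zero normal component on all faces of $\Omega$. $\mathcal U^{(1),k}_{0,\mathrm{curl}}(\Omega)$ is the image under the 1-form pullback $(\phi^{-1})^*$ of the space of fields $\big(y(1-y)zq_1,\ x(1-x)zq_2,\ x(1-x)y(1-y)\rho\big)^T$ with $q_1\in Q_{k+1}^{k-1,k-2,k-2}$, $q_2\in Q_{k+1}^{k-2,k-1,k-2}$, $\rho\in Q_{k+1}^{k-2,k-2,0}$. $\mathcal U^{(2),k}_{0,\mathrm{div}}(\Omega)$ is the image under the 2-form pullback $(\phi^{-1})^*$ of the space of fields $$\tfrac{z^{k-1}}{(1+z)^{k+2}}\big(r_y+2t,\ r_x+2s,\ (1+z)(r_{xy}+s_y+t_x)\big)^T+(0,0,z\chi_3)^T$$ with $r=x(1-x)y(1-y)p$, $p\in Q^{k-2,k-2}[x,y]$; $t=x(1-x)\tilde t$, $\tilde t\in P^{k-2}(x)$; $s=y(1-y)\tilde s$, $\tilde s\in P^{k-2}(y)$; $\chi_3\in Q_{k+2}^{k-1,k-1,k-2}$. *)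

theory Defs
  imports "HOL-Analysis.Analysis"
begin

section \<open>The finite and the infinite pyramid\<close>

definition apex :: "real^3" where
  "apex = vector [0, 0, 1]"

definition pyramid :: "(real^3) set" where
  "pyramid = {p. p$1 \<ge> 0 \<and> p$2 \<ge> 0 \<and> p$3 \<ge> 0 \<and> p$1 \<le> 1 - p$3 \<and> p$2 \<le> 1 - p$3}"

text \<open>The ideal point \<open>\<infinity>\<close> of the infinite pyramid, which corresponds to the apex, is left out:
  the fields below are rational and need not have a value there.\<close>

definition inf_pyramid :: "(real^3) set" where
  "inf_pyramid = {p. 0 \<le> p$1 \<and> p$1 \<le> 1 \<and> 0 \<le> p$2 \<and> p$2 \<le> 1 \<and> p$3 \<ge> 0}"

definition phi :: "real^3 \<Rightarrow> real^3" where
  "phi p = vector [p$1 / (1 + p$3), p$2 / (1 + p$3), p$3 / (1 + p$3)]"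

text \<open>The five faces of the pyramid, each paired with an outward normal (not normalised).\<close>

definition pyramid_faces :: "((real^3) set \<times> (real^3)) set" where
  "pyramid_faces =
    {({p \<in> pyramid. p$1 = 0}, vector [-1, 0, 0]),
     ({p \<in> pyramid. p$2 = 0}, vector [0, -1, 0]),
     ({p \<in> pyramid. p$3 = 0}, vector [0, 0, -1]),
     ({p \<in> pyramid. p$1 = 1 - p$3}, vector [1, 0, 1]),
     ({p \<in> pyramid. p$2 = 1 - p$3}, vector [0, 1, 1])}"

section \<open>Pullbacks and curl\<close>

definition pullback1 :: "(real^3 \<Rightarrow> real^3) \<Rightarrow> (real^3 \<Rightarrow> real^3) \<Rightarrow> real^3 \<Rightarrow> real^3" where
  "pullback1 f E p = transpose (jacobian f (at p)) *v E (f p)"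

definition pullback2 :: "(real^3 \<Rightarrow> real^3) \<Rightarrow> (real^3 \<Rightarrow> real^3) \<Rightarrow> real^3 \<Rightarrow> real^3" where
  "pullback2 f v p = det (jacobian f (at p)) *\<^sub>R (matrix_inv (jacobian f (at p)) *v v (f p))"

text \<open>Images of a space of fields under \<open>(\<phi>\<inverse>)\<^sup>* = (\<phi>\<^sup>*)\<inverse>\<close>.  A field on the finite pyramid is
  represented by a total function of which only the values on the pyramid without its apex
  (the image of the infinite pyramid under \<open>\<phi>\<close>) matter.\<close>

definition push1 :: "(real^3 \<Rightarrow> real^3) set \<Rightarrow> (real^3 \<Rightarrow> real^3) set" where
  "push1 U = {E. \<exists>u\<in>U. \<forall>p\<in>inf_pyramid. pullback1 phi E p = u p}"

definition push2 :: "(real^3 \<Rightarrow> real^3) set \<Rightarrow> (real^3 \<Rightarrow> real^3) set" where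
  "push2 U = {v. \<exists>u\<in>U. \<forall>p\<in>inf_pyramid. pullback2 phi v p = u p}"

text \<open>The derivative is taken within \<open>S\<close>, so that the curl of a field on the pyramid is
  determined by the values of the field on the pyramid, also at boundary points.\<close>

definition curl_on :: "(real^3) set \<Rightarrow> (real^3 \<Rightarrow> real^3) \<Rightarrow> real^3 \<Rightarrow> real^3" where
  "curl_on S w p = (let J = jacobian w (at p within S) in
     vector [J$3$2 - J$2$3, J$1$3 - J$3$1, J$2$1 - J$1$2])"

section \<open>Polynomial and rational spaces\<close>

text \<open>Degrees are integers.  For a negative degree the index set \<open>{..<nat (n + 1)}\<close> is empty and
  the space is \<open>{0}\<close>.\<close>

definition poly_P1 :: "int \<Rightarrow> (real \<Rightarrow> real) set" where
  "poly_P1 n = {f. \<exists>c. \<forall>x. f x = (\<Sum>i<nat (n + 1). c i * x ^ i)}"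

definition poly_Q2 :: "int \<Rightarrow> int \<Rightarrow> (real \<Rightarrow> real \<Rightarrow> real) set" where
  "poly_Q2 l m = {f. \<exists>c. \<forall>x y. f x y =
     (\<Sum>i<nat (l + 1). \<Sum>j<nat (m + 1). c i j * x ^ i * y ^ j)}"

definition poly_Q3 :: "int \<Rightarrow> int \<Rightarrow> int \<Rightarrow> (real \<Rightarrow> real \<Rightarrow> real \<Rightarrow> real) set" where
  "poly_Q3 l m n = {f. \<exists>c. \<forall>x y z. f x y z =
     (\<Sum>i<nat (l + 1). \<Sum>j<nat (m + 1). \<Sum>h<nat (n + 1). c i j h * x ^ i * y ^ j * z ^ h)}"

definition poly_P2 :: "int \<Rightarrow> (real \<Rightarrow> real \<Rightarrow> real) set" where
  "poly_P2 n = {f. \<exists>c. \<forall>w z. f w z =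
     (\<Sum>i<nat (n + 1). \<Sum>j<nat (n + 1 - int i). c i j * w ^ i * z ^ j)}"

definition rat_Q :: "nat \<Rightarrow> int \<Rightarrow> int \<Rightarrow> int \<Rightarrow> (real \<Rightarrow> real \<Rightarrow> real \<Rightarrow> real) set" where
  "rat_Q d l m n = {\<lambda>x y z. u x y z / (1 + z) ^ d | u. u \<in> poly_Q3 l m n}"

definition rat_P :: "nat \<Rightarrow> int \<Rightarrow> (real \<Rightarrow> real \<Rightarrow> real) set" where
  "rat_P d n = {\<lambda>w z. u w z / (1 + z) ^ d | u. u \<in> poly_P2 n}"

definition dx :: "(real \<Rightarrow> real \<Rightarrow> real) \<Rightarrow> real \<Rightarrow> real \<Rightarrow> real" where
  "dx f x y = deriv (\<lambda>a. f a y) x"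

definition dy :: "(real \<Rightarrow> real \<Rightarrow> real) \<Rightarrow> real \<Rightarrow> real \<Rightarrow> real" where
  "dy f x y = deriv (\<lambda>b. f x b) y"

definition field3 :: "(real \<Rightarrow> real \<Rightarrow> real \<Rightarrow> real) \<Rightarrow> (real \<Rightarrow> real \<Rightarrow> real \<Rightarrow> real) \<Rightarrow>
    (real \<Rightarrow> real \<Rightarrow> real \<Rightarrow> real) \<Rightarrow> real^3 \<Rightarrow> real^3" where
  "field3 f g h p =
     vector [f (p$1) (p$2) (p$3), g (p$1) (p$2) (p$3), h (p$1) (p$2) (p$3)]"

section \<open>The approximation spaces\<close>

definition U2_inf :: "nat \<Rightarrow> (real^3 \<Rightarrow> real^3) set" where
  "U2_inf k = {u.
     (\<exists>a \<in> rat_Q (k + 2) (int k) (int k - 1) (int k - 2).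
      \<exists>b \<in> rat_Q (k + 2) (int k - 1) (int k) (int k - 2).
      \<exists>c \<in> rat_Q (k + 2) (int k - 1) (int k - 1) (int k - 1).
      \<exists>s \<in> poly_Q2 (int k - 1) (int k).
      \<exists>t \<in> poly_Q2 (int k) (int k - 1).
        u = (\<lambda>p. field3 a b c p
          + field3 (\<lambda>x y z. 0)
                   (\<lambda>x y z. z ^ (k - 1) / (1 + z) ^ (k + 2) * (2 * s x y))
                   (\<lambda>x y z. z ^ (k - 1) / (1 + z) ^ (k + 2) * (dy s x y * (1 + z))) p
          + field3 (\<lambda>x y z. z ^ (k - 1) / (1 + z) ^ (k + 2) * (2 * t x y))
                   (\<lambda>x y z. 0)
                   (\<lambda>x y z. z ^ (k - 1) / (1 + z) ^ (k + 2) * (dx t x y * (1 + z))) p))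
   \<and> (\<forall>y\<in>{0, 1}. \<exists>g \<in> rat_P (k + 2) (int k - 1).
        \<forall>x\<in>{0..1}. \<forall>z\<ge>0. u (vector [x, y, z]) $ 2 = g x z)
   \<and> (\<forall>x\<in>{0, 1}. \<exists>g \<in> rat_P (k + 2) (int k - 1).
        \<forall>y\<in>{0..1}. \<forall>z\<ge>0. u (vector [x, y, z]) $ 1 = g y z)}"

definition U2 :: "nat \<Rightarrow> (real^3 \<Rightarrow> real^3) set" where
  "U2 k = push2 (U2_inf k)"

definition U2_0 :: "nat \<Rightarrow> (real^3 \<Rightarrow> real^3) set" where
  "U2_0 k = {v \<in> U2 k. \<forall>(F, n)\<in>pyramid_faces. \<forall>p\<in>F - {apex}. v p \<bullet> n = 0}"

definition U1_0_curl :: "nat \<Rightarrow> (real^3 \<Rightarrow> real^3) set" where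
  "U1_0_curl k = push1 {field3
      (\<lambda>x y z. y * (1 - y) * z * q1 x y z)
      (\<lambda>x y z. x * (1 - x) * z * q2 x y z)
      (\<lambda>x y z. x * (1 - x) * y * (1 - y) * \<rho> x y z) | q1 q2 \<rho>.
        q1 \<in> rat_Q (k + 1) (int k - 1) (int k - 2) (int k - 2) \<and>
        q2 \<in> rat_Q (k + 1) (int k - 2) (int k - 1) (int k - 2) \<and>
        \<rho> \<in> rat_Q (k + 1) (int k - 2) (int k - 2) 0}"

definition U2_0_div :: "nat \<Rightarrow> (real^3 \<Rightarrow> real^3) set" where
  "U2_0_div k = push2 {field3
      (\<lambda>x y z. z ^ (k - 1) / (1 + z) ^ (k + 2) * (dy r x y + 2 * t x y))
      (\<lambda>x y z. z ^ (k - 1) / (1 + z) ^ (k + 2) * (dx r x y + 2 * s x y))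
      (\<lambda>x y z. z ^ (k - 1) / (1 + z) ^ (k + 2) *
                 ((1 + z) * (dy (dx r) x y + dy s x y + dx t x y))
               + z * \<chi>3 x y z) | r s t \<chi>3.
        (\<exists>p \<in> poly_Q2 (int k - 2) (int k - 2).
           r = (\<lambda>x y. x * (1 - x) * y * (1 - y) * p x y)) \<and>
        (\<exists>t' \<in> poly_P1 (int k - 2). t = (\<lambda>x y. x * (1 - x) * t' x)) \<and>
        (\<exists>s' \<in> poly_P1 (int k - 2). s = (\<lambda>x y. y * (1 - y) * s' y)) \<and>
        \<chi>3 \<in> rat_Q (k + 2) (int k - 1) (int k - 1) (int k - 2)}"

end

theory Submission
  imports Defs
begin

text \<open>Pulling everything back by \<open>\<phi>\<close>, it suffices to decompose \<open>u = \<phi>\<^sup>* v\<close> on the infinite pyramid, because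
  pullbacks commute with the curl.  The vanishing normal components force \<open>u\<^sub>1 = x (1 - x) a\<close>,
  \<open>u\<^sub>2 = y (1 - y) b\<close> and \<open>z\<close> to divide \<open>u\<^sub>3\<close>.  In the first two components the equation
  \<open>u = curl W + w\<close> reads, after removal of the bubble factors, \<open>\<partial>\<^sub>z (z q\<^sub>2) = \<dots>\<close> and \<open>\<partial>\<^sub>z (z q\<^sub>1) = \<dots>\<close>, with
  right-hand sides that depend on \<open>\<rho>\<close>, \<open>p\<close>, \<open>s\<close>, \<open>t\<close>.  Each is solvable iff the right-hand side has integral
  zero over \<open>z \<ge> 0\<close>, that is, iff prescribed polynomials \<open>\<alpha>\<^sub>1\<close>, \<open>\<alpha>\<^sub>2\<close> in \<open>x, y\<close> have the form
  \<open>\<partial>\<^sub>y (y (1 - y) P\<^sub>1) + T\<^sub>1 x\<close> and \<open>\<partial>\<^sub>x (x (1 - x) P\<^sub>2) + T\<^sub>2 y\<close>, where \<open>P\<^sub>1\<close> and \<open>P\<^sub>2\<close> are independent combinations of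
  \<open>p\<close> and \<open>\<rho>\<close>.  The third component of the remainder is divisible by \<open>z\<close>, and the
  leading coefficients in \<open>z\<close> cancel, so that it is absorbed by \<open>z \<chi>\<^sub>3\<close>.\<close>

section \<open>Polynomials in two variables\<close>

definition unipoly :: "nat \<Rightarrow> (real \<Rightarrow> real) set" where
  "unipoly L = {f. \<exists>c. \<forall>x. f x = (\<Sum>i<L. c i * x ^ i)}"

text \<open>\<open>L\<close> and \<open>M\<close> count coefficients, so degrees lie strictly below
  them and a zero count gives the zero space. Truncated subtraction then describes the space
  correctly after a derivative (\<open>L - 1\<close>) or after removal of a bubble factor
  (\<open>L - 2\<close>).\<close>

definition bipoly :: "nat \<Rightarrow> nat \<Rightarrow> (real \<Rightarrow> real \<Rightarrow> real) set" where
  "bipoly L M = {f. \<exists>c. \<forall>x y. f x y = (\<Sum>i<L. \<Sum>j<M. c i j * x ^ i * y ^ j)}"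

lemma poly_P1_unipoly: "poly_P1 n = unipoly (nat (n + 1))"
  by (simp add: poly_P1_def unipoly_def)

lemma poly_Q2_bipoly: "poly_Q2 l m = bipoly (nat (l + 1)) (nat (m + 1))"
  by (simp add: poly_Q2_def bipoly_def)

lemma bipolyI: "(\<And>x y. f x y = (\<Sum>i<L. \<Sum>j<M. c i j * x ^ i * y ^ j)) \<Longrightarrow> f \<in> bipoly L M"
  unfolding bipoly_def by blast

lemma sum_rotate: "(\<Sum>i\<in>A. \<Sum>j\<in>B. \<Sum>h\<in>C. f i j h) = (\<Sum>h\<in>C. \<Sum>i\<in>A. \<Sum>j\<in>B. f i j h)"
proof -
  have "(\<Sum>i\<in>A. \<Sum>j\<in>B. \<Sum>h\<in>C. f i j h) = (\<Sum>i\<in>A. \<Sum>h\<in>C. \<Sum>j\<in>B. f i j h)"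
    by (rule sum.cong[OF refl], rule sum.swap)
  also have "\<dots> = (\<Sum>h\<in>C. \<Sum>i\<in>A. \<Sum>j\<in>B. f i j h)"
    by (rule sum.swap)
  finally show ?thesis .
qed

text \<open>Fields are compared power by power in \<open>z\<close>, so a polynomial in three
  variables is treated as a sequence of coefficients in \<open>x, y\<close>. The family
  \<open>F\<close> is total with all members in the space, which spares index conditions
  later.\<close>

lemma poly_Q3_iff:
  "f \<in> poly_Q3 l m n \<longleftrightarrow>
    (\<exists>F. (\<forall>h. F h \<in> bipoly (nat (l + 1)) (nat (m + 1))) \<and>
         f = (\<lambda>x y z. \<Sum>h<nat (n + 1). F h x y * z ^ h))" (is "_ \<longleftrightarrow> ?R")
proof
  assume "f \<in> poly_Q3 l m n"
  then obtain c where c: "\<And>x y z. f x y z =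
     (\<Sum>i<nat (l + 1). \<Sum>j<nat (m + 1). \<Sum>h<nat (n + 1). c i j h * x ^ i * y ^ j * z ^ h)"
    unfolding poly_Q3_def by blast
  have "f x y z = (\<Sum>h<nat (n + 1).
      (\<Sum>i<nat (l + 1). \<Sum>j<nat (m + 1). c i j h * x ^ i * y ^ j) * z ^ h)" for x y z
    unfolding c sum_distrib_right
    by (rule sum_rotate)
  then have "f = (\<lambda>x y z. \<Sum>h<nat (n + 1).
      (\<Sum>i<nat (l + 1). \<Sum>j<nat (m + 1). c i j h * x ^ i * y ^ j) * z ^ h)"
    by (intro ext)
  then show ?R
    by (intro exI[of _ "\<lambda>h x y. \<Sum>i<nat (l + 1). \<Sum>j<nat (m + 1). c i j h * x ^ i * y ^ j"])
      (auto intro: bipolyI)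
next
  assume ?R
  then obtain F where F: "\<And>h. F h \<in> bipoly (nat (l + 1)) (nat (m + 1))"
    and f: "f = (\<lambda>x y z. \<Sum>h<nat (n + 1). F h x y * z ^ h)"
    by blast
  obtain c where c: "\<And>h x y. F h x y =
      (\<Sum>i<nat (l + 1). \<Sum>j<nat (m + 1). c h i j * x ^ i * y ^ j)"
  proof -
    have "\<exists>c. \<forall>x y. F h x y = (\<Sum>i<nat (l + 1). \<Sum>j<nat (m + 1). c i j * x ^ i * y ^ j)" for h
      using F[of h] by (simp add: bipoly_def)
    then have "\<exists>c. \<forall>h x y. F h x y = (\<Sum>i<nat (l + 1). \<Sum>j<nat (m + 1). c h i j * x ^ i * y ^ j)"
      by (intro choice allI)
    then show thesis
      using that by blast
  qed
  have "f x y z =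
     (\<Sum>i<nat (l + 1). \<Sum>j<nat (m + 1). \<Sum>h<nat (n + 1). c h i j * x ^ i * y ^ j * z ^ h)" for x y z
    unfolding f c sum_distrib_right
    by (rule sum_rotate[symmetric])
  then show "f \<in> poly_Q3 l m n"
    unfolding poly_Q3_def mem_Collect_eq by (intro exI[of _ "\<lambda>i j h. c h i j"]) blast
qed

lemma bipoly_zero: "(\<lambda>x y. 0) \<in> bipoly L M"
  by (rule bipolyI[where c = "\<lambda>i j. 0"]) simp

lemma bipoly_add:
  assumes "f \<in> bipoly L M" "g \<in> bipoly L M"
  shows "(\<lambda>x y. f x y + g x y) \<in> bipoly L M"
proof -
  obtain c d where "\<And>x y. f x y = (\<Sum>i<L. \<Sum>j<M. c i j * x ^ i * y ^ j)"
    "\<And>x y. g x y = (\<Sum>i<L. \<Sum>j<M. d i j * x ^ i * y ^ j)"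
    using assms unfolding bipoly_def by blast
  then show ?thesis
    by (intro bipolyI[where c = "\<lambda>i j. c i j + d i j"]) (simp add: sum.distrib algebra_simps)
qed

lemma bipoly_cmult:
  assumes "f \<in> bipoly L M"
  shows "(\<lambda>x y. a * f x y) \<in> bipoly L M"
proof -
  obtain c where "\<And>x y. f x y = (\<Sum>i<L. \<Sum>j<M. c i j * x ^ i * y ^ j)"
    using assms unfolding bipoly_def by blast
  then show ?thesis
    by (intro bipolyI[where c = "\<lambda>i j. a * c i j"]) (simp add: sum_distrib_left algebra_simps)
qed

lemma bipoly_diff:
  assumes "f \<in> bipoly L M" "g \<in> bipoly L M"
  shows "(\<lambda>x y. f x y - g x y) \<in> bipoly L M"
  using bipoly_add[OF assms(1) bipoly_cmult[OF assms(2), of "-1"]] by simp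

lemma bipoly_divide: "f \<in> bipoly L M \<Longrightarrow> (\<lambda>x y. f x y / a) \<in> bipoly L M"
  using bipoly_cmult[of f L M "1 / a"] by simp

lemma bipoly_sum:
  "(\<And>i. i \<in> I \<Longrightarrow> f i \<in> bipoly L M) \<Longrightarrow> (\<lambda>x y. \<Sum>i\<in>I. f i x y) \<in> bipoly L M"
  by (induction I rule: infinite_finite_induct) (auto intro: bipoly_zero bipoly_add)

lemma bipoly_monom:
  assumes "i < L" "j < M"
  shows "(\<lambda>x y. x ^ i * y ^ j) \<in> bipoly L M"
proof (rule bipolyI[where c = "\<lambda>i' j'. if i' = i \<and> j' = j then 1 else 0"])
  fix x y :: real
  have "(\<Sum>j'<M. (if i' = i \<and> j' = j then 1 else 0) * x ^ i' * y ^ j') =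
      (if i' = i then x ^ i * y ^ j else 0)" for i'
    using assms(2) by (subst sum.remove[of _ j]) (auto intro!: sum.neutral)
  then show "x ^ i * y ^ j =
      (\<Sum>i'<L. \<Sum>j'<M. (if i' = i \<and> j' = j then 1 else 0) * x ^ i' * y ^ j')"
    using assms(1) by simp
qed

text \<open>Any claim preserved by linear combinations reduces to monomials. The division and
  primitive lemmas below are proved this way, since their witnesses can be chosen linearly in
  \<open>f\<close>.\<close>

lemma bipoly_induct [consumes 1, case_names zero monom add cmult]:
  assumes "f \<in> bipoly L M"
    and zero: "Q (\<lambda>x y. 0)"
    and monom: "\<And>i j. i < L \<Longrightarrow> j < M \<Longrightarrow> Q (\<lambda>x y. x ^ i * y ^ j)"
    and add: "\<And>f g. Q f \<Longrightarrow> Q g \<Longrightarrow> Q (\<lambda>x y. f x y + g x y)"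
    and cmult: "\<And>a f. Q f \<Longrightarrow> Q (\<lambda>x y. a * f x y)"
  shows "Q f"
proof -
  obtain c where c: "\<And>x y. f x y = (\<Sum>i<L. \<Sum>j<M. c i j * x ^ i * y ^ j)"
    using assms unfolding bipoly_def by blast
  have Q_sum: "finite I \<Longrightarrow> (\<And>i. i \<in> I \<Longrightarrow> Q (F i)) \<Longrightarrow> Q (\<lambda>x y. \<Sum>i\<in>I. F i x y)"
    for F and I :: "nat set"
    by (induction I rule: finite_induct) (auto intro: zero add)
  have "f = (\<lambda>x y. \<Sum>i<L. \<Sum>j<M. c i j * (x ^ i * y ^ j))"
    by (intro ext) (simp add: c mult.assoc)
  moreover have "Q (\<lambda>x y. \<Sum>i<L. \<Sum>j<M. c i j * (x ^ i * y ^ j))"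
    by (intro Q_sum cmult monom) auto
  ultimately show ?thesis
    by simp
qed

lemma bipoly_swap: "f \<in> bipoly L M \<Longrightarrow> (\<lambda>x y. f y x) \<in> bipoly M L"
proof (induction rule: bipoly_induct)
  case (monom i j)
  then show ?case
    using bipoly_monom[of j M i L] by (simp add: mult.commute)
qed (auto intro: bipoly_zero bipoly_add bipoly_cmult)

lemma bipoly_mono: "f \<in> bipoly L M \<Longrightarrow> L \<le> L' \<Longrightarrow> M \<le> M' \<Longrightarrow> f \<in> bipoly L' M'"
  by (induction rule: bipoly_induct)
    (auto intro: bipoly_zero bipoly_add bipoly_cmult bipoly_monom)

lemma bipoly_unipoly:
  assumes "f \<in> unipoly L" "M > 0"
  shows "(\<lambda>x y. f x) \<in> bipoly L M"
proof -
  obtain c where c: "\<And>x. f x = (\<Sum>i<L. c i * x ^ i)"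
    using assms unfolding unipoly_def by blast
  have "(\<lambda>x y. \<Sum>i<L. c i * (x ^ i * y ^ 0)) \<in> bipoly L M"
    using assms(2) by (intro bipoly_sum bipoly_cmult bipoly_monom) auto
  then show ?thesis
    by (simp add: c)
qed

lemma bipoly_xmult: "f \<in> bipoly L M \<Longrightarrow> (\<lambda>x y. x * f x y) \<in> bipoly (Suc L) M"
proof (induction rule: bipoly_induct)
  case (monom i j)
  then show ?case
    using bipoly_monom[of "Suc i" "Suc L" j M] by (simp add: mult.assoc)
next
  case (add f g)
  then show ?case
    using bipoly_add[OF add] by (simp add: algebra_simps)
next
  case (cmult a f)
  then show ?case
    using bipoly_cmult[OF cmult, of a] by (simp add: algebra_simps)
qed (auto intro: bipoly_zero)

lemma bipoly_xbubble:
  assumes "f \<in> bipoly L M"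
  shows "(\<lambda>x y. x * (1 - x) * f x y) \<in> bipoly (Suc (Suc L)) M"
proof -
  have "(\<lambda>x y. x * f x y) \<in> bipoly (Suc (Suc L)) M"
    using bipoly_mono[OF bipoly_xmult[OF assms], of "Suc (Suc L)" M] by simp
  from bipoly_diff[OF this bipoly_xmult[OF bipoly_xmult[OF assms]]]
  show ?thesis
    by (simp add: algebra_simps)
qed

lemma bipoly_ybubble:
  "f \<in> bipoly L M \<Longrightarrow> (\<lambda>x y. y * (1 - y) * f x y) \<in> bipoly L (Suc (Suc M))"
  using bipoly_swap[OF bipoly_xbubble[OF bipoly_swap]] by simp

section \<open>Partial derivatives of polynomials\<close>

lemma has_derivative_bipoly_aux:
  assumes "f \<in> bipoly L M"
  shows "\<exists>g h. (\<forall>p. ((\<lambda>p::real^3. f (p$1) (p$2)) has_derivative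
      (\<lambda>d. g (p$1) (p$2) * d$1 + h (p$1) (p$2) * d$2)) (at p)) \<and>
    (\<forall>x y. ((\<lambda>a. f a y) has_real_derivative g x y) (at x)) \<and>
    (\<forall>x y. ((\<lambda>b. f x b) has_real_derivative h x y) (at y)) \<and>
    g \<in> bipoly (L - 1) M \<and> h \<in> bipoly L (M - 1) \<and>
    (\<exists>m. (\<forall>x y. ((\<lambda>b. g x b) has_real_derivative m x y) (at y)) \<and>
         (\<forall>x y. ((\<lambda>a. h a y) has_real_derivative m x y) (at x)))"
proof -
  obtain c where "\<And>x y. f x y = (\<Sum>i<L. \<Sum>j<M. c i j * x ^ i * y ^ j)"
    using assms unfolding bipoly_def by blast
  then have f: "f = (\<lambda>x y. \<Sum>i<L. \<Sum>j<M. c i j * x ^ i * y ^ j)"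
    by (intro ext)
  define g where "g = (\<lambda>x y. \<Sum>i<L. \<Sum>j<M. c i j * (real i * x ^ (i - 1)) * y ^ j)"
  define h where "h = (\<lambda>x y. \<Sum>i<L. \<Sum>j<M. c i j * x ^ i * (real j * y ^ (j - 1)))"
  \<comment> \<open>Differentiating \<open>g\<close> in \<open>y\<close> and \<open>h\<close> in
    \<open>x\<close> gives this same expression, whence the symmetry of mixed derivatives in
    \<open>dx_dy\<close>.\<close>
  define m where "m = (\<lambda>x y. \<Sum>i<L. \<Sum>j<M. c i j * (real i * x ^ (i - 1)) * (real j * y ^ (j - 1)))"
  have 1: "((\<lambda>p::real^3. f (p$1) (p$2)) has_derivative
      (\<lambda>d. g (p$1) (p$2) * d$1 + h (p$1) (p$2) * d$2)) (at p)" for p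
  proof -
    have "((\<lambda>p::real^3. c i j * (p$1) ^ i * (p$2) ^ j) has_derivative
        (\<lambda>d. c i j * (real i * (p$1) ^ (i - 1)) * (p$2) ^ j * d$1 +
             c i j * (p$1) ^ i * (real j * (p$2) ^ (j - 1)) * d$2)) (at p)" for i j
      by (auto intro!: derivative_eq_intros bounded_linear_imp_has_derivative bounded_linear_vec_nth
          simp: algebra_simps)
    then have "((\<lambda>p::real^3. f (p$1) (p$2)) has_derivative
        (\<lambda>d. \<Sum>i<L. \<Sum>j<M. c i j * (real i * (p$1) ^ (i - 1)) * (p$2) ^ j * d$1 +
             c i j * (p$1) ^ i * (real j * (p$2) ^ (j - 1)) * d$2)) (at p)"
      unfolding f by (intro has_derivative_sum)
    then show ?thesis
      unfolding g_def h_def by (simp add: sum.distrib sum_distrib_right)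
  qed
  have x: "((\<lambda>a. C * a ^ i * b) has_real_derivative C * (real i * x ^ (i - 1)) * b) (at x)"
    and y: "((\<lambda>a. C * a ^ i) has_real_derivative C * (real i * x ^ (i - 1))) (at x)" for C i b x
    by (auto intro!: derivative_eq_intros)
  have 2: "((\<lambda>a. f a y) has_real_derivative g x y) (at x)"
    "((\<lambda>b. f x b) has_real_derivative h x y) (at y)"
    "((\<lambda>b. g x b) has_real_derivative m x y) (at y)"
    "((\<lambda>a. h a y) has_real_derivative m x y) (at x)" for x y
    unfolding f g_def h_def m_def by (intro DERIV_sum x y)+
  have "(\<lambda>x y. \<Sum>i<L. \<Sum>j<M. (c i j * real i) * (x ^ (i - 1) * y ^ j)) \<in> bipoly (L - 1) M"
  proof (intro bipoly_sum)
    \<comment> \<open>For \<open>i = 0\<close> the factor \<open>real i\<close> kills the term, so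
      the truncated exponent \<open>i - 1\<close> does no harm; otherwise
      \<open>i - 1 < L - 1\<close>.\<close>
    fix i j assume "i \<in> {..<L}" "j \<in> {..<M}"
    then show "(\<lambda>x y. (c i j * real i) * (x ^ (i - 1) * y ^ j)) \<in> bipoly (L - 1) M"
      by (cases "i = 0") (simp add: bipoly_zero, intro bipoly_cmult bipoly_monom, auto)
  qed
  then have g: "g \<in> bipoly (L - 1) M"
    by (simp add: g_def mult.assoc)
  have "(\<lambda>x y. \<Sum>i<L. \<Sum>j<M. (c i j * real j) * (x ^ i * y ^ (j - 1))) \<in> bipoly L (M - 1)"
  proof (intro bipoly_sum)
    fix i j assume "i \<in> {..<L}" "j \<in> {..<M}"
    then show "(\<lambda>x y. (c i j * real j) * (x ^ i * y ^ (j - 1))) \<in> bipoly L (M - 1)"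
      by (cases "j = 0") (simp add: bipoly_zero, intro bipoly_cmult bipoly_monom, auto)
  qed
  then have h: "h \<in> bipoly L (M - 1)"
    by (simp add: h_def mult.assoc mult.left_commute)
  show ?thesis
    by (intro exI conjI allI) (rule 1 2 g h)+
qed

lemma
  assumes f: "f \<in> bipoly L M"
  shows DERIV_dx: "((\<lambda>a. f a y) has_real_derivative dx f x y) (at x)"
    and DERIV_dy: "((\<lambda>b. f x b) has_real_derivative dy f x y) (at y)"
    and bipoly_dx: "dx f \<in> bipoly (L - 1) M"
    and bipoly_dy: "dy f \<in> bipoly L (M - 1)"
    and dx_dy: "dx (dy f) x y = dy (dx f) x y"
    and has_derivative_bipoly: "((\<lambda>p::real^3. f (p$1) (p$2)) has_derivative
      (\<lambda>d. dx f (p$1) (p$2) * d$1 + dy f (p$1) (p$2) * d$2)) (at p)"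
proof -
  from has_derivative_bipoly_aux[OF f] obtain g h m where
    1: "\<And>p. ((\<lambda>p::real^3. f (p$1) (p$2)) has_derivative
      (\<lambda>d. g (p$1) (p$2) * d$1 + h (p$1) (p$2) * d$2)) (at p)"
    "\<And>x y. ((\<lambda>a. f a y) has_real_derivative g x y) (at x)"
    "\<And>x y. ((\<lambda>b. f x b) has_real_derivative h x y) (at y)"
    "g \<in> bipoly (L - 1) M" "h \<in> bipoly L (M - 1)"
    "\<And>x y. ((\<lambda>b. g x b) has_real_derivative m x y) (at y)"
    "\<And>x y. ((\<lambda>a. h a y) has_real_derivative m x y) (at x)" by blast
  have eq: "dx f = g" "dy f = h"
    using 1(2,3) by (auto intro!: ext DERIV_imp_deriv simp: dx_def dy_def)
  then show "((\<lambda>a. f a y) has_real_derivative dx f x y) (at x)"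
    "((\<lambda>b. f x b) has_real_derivative dy f x y) (at y)"
    "dx f \<in> bipoly (L - 1) M" "dy f \<in> bipoly L (M - 1)"
    "((\<lambda>p::real^3. f (p$1) (p$2)) has_derivative
      (\<lambda>d. dx f (p$1) (p$2) * d$1 + dy f (p$1) (p$2) * d$2)) (at p)"
    using 1 by auto
  show "dx (dy f) x y = dy (dx f) x y"
    unfolding eq using DERIV_imp_deriv[OF 1(6)] DERIV_imp_deriv[OF 1(7)]
    by (simp add: dx_def dy_def)
qed

lemma
  assumes "f \<in> bipoly L M" "g \<in> bipoly L' M'"
  shows dy_add: "dy (\<lambda>x y. f x y + g x y) x y = dy f x y + dy g x y"
    and dx_diff: "dx (\<lambda>x y. f x y - g x y) x y = dx f x y - dx g x y"
    and dy_diff: "dy (\<lambda>x y. f x y - g x y) x y = dy f x y - dy g x y"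
  unfolding dy_def[of "\<lambda>x y. _ x y + _ x y"]
    dx_def[of "\<lambda>x y. _ x y - _ x y"] dy_def[of "\<lambda>x y. _ x y - _ x y"]
  by (intro DERIV_imp_deriv DERIV_add DERIV_diff DERIV_dx[OF assms(1)] DERIV_dx[OF assms(2)]
      DERIV_dy[OF assms(1)] DERIV_dy[OF assms(2)])+

lemma
  assumes "f \<in> bipoly L M"
  shows dx_cmult: "dx (\<lambda>x y. g y * f x y) x y = g y * dx f x y"
    and dy_cmult: "dy (\<lambda>x y. g x * f x y) x y = g x * dy f x y"
  unfolding dx_def[of "\<lambda>x y. _ y * _ x y"] dy_def[of "\<lambda>x y. _ x * _ x y"]
  by (intro DERIV_imp_deriv DERIV_cmult DERIV_dx[OF assms] DERIV_dy[OF assms])+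

section \<open>Zeros of polynomials and division by bubble factors\<close>

lemma polyfun_zero_coeff:
  fixes c :: "nat \<Rightarrow> real"
  assumes "infinite S" "\<And>z. z \<in> S \<Longrightarrow> (\<Sum>h<n. c h * z ^ h) = 0" "h < n"
  shows "c h = 0"
proof (rule ccontr)
  assume "c h \<noteq> 0"
  have "{..<n} = {..n - 1}"
    using assms(3) by auto
  then have "S \<subseteq> {z. (\<Sum>i\<le>n - 1. c i * z ^ i) = 0}"
    using assms(2) by auto
  moreover have "finite {z. (\<Sum>i\<le>n - 1. c i * z ^ i) = 0}"
    unfolding polyfun_finite_roots using \<open>c h \<noteq> 0\<close> assms(3) by (intro exI[of _ h]) auto
  ultimately show False
    using assms(1) finite_subset by blast
qed

text \<open>For fixed \<open>x\<close> the polynomial in \<open>y\<close> has infinitely many roots,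
  so its coefficients vanish. This extends face conditions known only on [0, 1] to all real
  arguments.\<close>

lemma bipoly_zero_extend:
  assumes "f \<in> bipoly L M" "infinite S" "\<And>y. y \<in> S \<Longrightarrow> f x y = 0"
  shows "f x y = 0"
proof -
  obtain c where "\<And>x y. f x y = (\<Sum>i<L. \<Sum>j<M. c i j * x ^ i * y ^ j)"
    using assms unfolding bipoly_def by blast
  then have f: "f x y = (\<Sum>j<M. (\<Sum>i<L. c i j * x ^ i) * y ^ j)" for y
    by (simp only: sum_distrib_right) (rule sum.swap)
  have "(\<Sum>i<L. c i j * x ^ i) = 0" if "j < M" for j
    by (rule polyfun_zero_coeff[OF assms(2) _ that]) (simp add: f[symmetric] assms(3))
  then show ?thesis
    by (simp add: f)
qed

text \<open>The finite geometric sum, read as the quotient of \<open>x - x ^ Suc i\<close> by the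
  bubble; it serves both the division and the primitives.\<close>

lemma power_minus_power: "x * (1 - x) * (\<Sum>m<i. x ^ m) = x - x ^ Suc i" for x :: real
  unfolding mult.assoc one_diff_power_eq[symmetric] by (simp add: algebra_simps)

text \<open>Subtracting from \<open>f\<close> the linear interpolant of its values at
  \<open>x = 0\<close> and \<open>x = 1\<close> leaves a polynomial vanishing at both points, hence
  divisible by the bubble.\<close>

lemma bipoly_xdivision:
  "f \<in> bipoly L M \<Longrightarrow>
    \<exists>g\<in>bipoly (L - 2) M. \<forall>x y. f x y = x * (1 - x) * g x y + (1 - x) * f 0 y + x * f 1 y"
proof (induction rule: bipoly_induct)
  case zero
  then show ?case
    by (intro bexI[of _ "\<lambda>_ _. 0"] bipoly_zero) auto
next
  case (monom i j)
  \<comment> \<open>For i >= 1 this is x^i = x - x (1 - x) (1 + ... + x^(i-2)). For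
    \<open>i = 0\<close> truncated subtraction leaves the empty sum, as it should, because (1 - x) +
    x = 1.\<close>
  have "(\<lambda>x y. - 1 * (\<Sum>m<i - 1. x ^ m * y ^ j)) \<in> bipoly (L - 2) M"
    using monom by (intro bipoly_cmult bipoly_sum bipoly_monom) auto
  moreover have "x ^ i * y ^ j = x * (1 - x) * (- 1 * (\<Sum>m<i - 1. x ^ m * y ^ j))
      + (1 - x) * (0 ^ i * y ^ j) + x * (1 ^ i * y ^ j)" for x y :: real
  proof (cases i)
    case (Suc i')
    have "x * (1 - x) * (- 1 * (\<Sum>m<i'. x ^ m * y ^ j)) = - (x * (1 - x) * (\<Sum>m<i'. x ^ m)) * y ^ j"
      by (simp add: sum_distrib_right)
    then show ?thesis
      unfolding power_minus_power Suc by (simp add: algebra_simps)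
  qed (simp add: algebra_simps)
  ultimately show ?case
    by (intro bexI[of _ "\<lambda>x y. - 1 * (\<Sum>m<i - 1. x ^ m * y ^ j)"] allI)
next
  case (add f f')
  then obtain g g' where 1: "g \<in> bipoly (L - 2) M" "g' \<in> bipoly (L - 2) M"
    and 2: "\<And>x y. f x y = x * (1 - x) * g x y + (1 - x) * f 0 y + x * f 1 y"
    "\<And>x y. f' x y = x * (1 - x) * g' x y + (1 - x) * f' 0 y + x * f' 1 y"
    by blast
  show ?case
  proof (intro bexI[OF _ bipoly_add[OF 1]] allI)
    fix x y
    show "f x y + f' x y = x * (1 - x) * (g x y + g' x y)
        + (1 - x) * (f 0 y + f' 0 y) + x * (f 1 y + f' 1 y)"
      by (subst 2(1), subst 2(2)) (simp only: algebra_simps)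
  qed
next
  case (cmult a f)
  then obtain g where 1: "g \<in> bipoly (L - 2) M"
    and 2: "\<And>x y. f x y = x * (1 - x) * g x y + (1 - x) * f 0 y + x * f 1 y"
    by blast
  show ?case
  proof (intro bexI[OF _ bipoly_cmult[OF 1]] allI)
    fix x y
    show "a * f x y = x * (1 - x) * (a * g x y) + (1 - x) * (a * f 0 y) + x * (a * f 1 y)"
      by (subst 2) (simp only: algebra_simps)
  qed
qed

lemma bipoly_xfactor:
  assumes "f \<in> bipoly L M" "infinite S" "\<And>y. y \<in> S \<Longrightarrow> f 0 y = 0" "\<And>y. y \<in> S \<Longrightarrow> f 1 y = 0"
  shows "\<exists>g\<in>bipoly (L - 2) M. \<forall>x y. f x y = x * (1 - x) * g x y"
  using bipoly_xdivision[OF assms(1)] bipoly_zero_extend[OF assms(1,2,3)]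
    bipoly_zero_extend[OF assms(1,2,4)]
  by simp

lemma bipoly_yfactor:
  assumes "f \<in> bipoly L M" "infinite S" "\<And>x. x \<in> S \<Longrightarrow> f x 0 = 0" "\<And>x. x \<in> S \<Longrightarrow> f x 1 = 0"
  shows "\<exists>g\<in>bipoly L (M - 2). \<forall>x y. f x y = y * (1 - y) * g x y"
proof -
  obtain g where "g \<in> bipoly (M - 2) L" "\<forall>x y. f y x = x * (1 - x) * g x y"
    using bipoly_xfactor[OF bipoly_swap[OF assms(1)] assms(2-)] by blast
  then show ?thesis
    by (intro bexI[OF _ bipoly_swap]) auto
qed

section \<open>Primitives that vanish at both ends of [0, 1]\<close>

lemma unipoly_iff: "f \<in> unipoly L \<longleftrightarrow> (\<lambda>x y. f x) \<in> bipoly L 1"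
  by (auto simp: unipoly_def bipoly_def)

lemma unipoly_add: "f \<in> unipoly L \<Longrightarrow> g \<in> unipoly L \<Longrightarrow> (\<lambda>x. f x + g x) \<in> unipoly L"
  unfolding unipoly_iff by (rule bipoly_add)

lemma unipoly_cmult: "f \<in> unipoly L \<Longrightarrow> (\<lambda>x. a * f x) \<in> unipoly L"
  unfolding unipoly_iff by (rule bipoly_cmult)

lemma unipoly_divide: "f \<in> unipoly L \<Longrightarrow> (\<lambda>x. f x / a) \<in> unipoly L"
  using unipoly_cmult[of f L "1 / a"] by simp

lemma unipoly_zero: "(\<lambda>x. 0) \<in> unipoly L"
  unfolding unipoly_iff by (rule bipoly_zero)

lemma unipoly_monom: "i < L \<Longrightarrow> (\<lambda>x. x ^ i) \<in> unipoly L"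
  unfolding unipoly_iff using bipoly_monom[of i L 0 1] by simp

text \<open>The constant term \<open>T\<close> is the mean of \<open>A x\<close> over \<open>[0, 1]\<close>.\<close>

lemma bipoly_yprimitive:
  "A \<in> bipoly L M \<Longrightarrow>
    \<exists>P\<in>bipoly L (M - 1). \<exists>T\<in>unipoly L. \<forall>x y. A x y = dy (\<lambda>x y. y * (1 - y) * P x y) x y + T x"
proof (induction rule: bipoly_induct)
  case zero
  then show ?case
    by (intro bexI[of _ "\<lambda>_ _. 0"] bexI[of _ "\<lambda>_. 0"] bipoly_zero unipoly_zero)
      (auto simp: dy_def)
next
  case (monom i j)
  \<comment> \<open>\<open>c\<close> is the mean of y^j over [0, 1]. The primitive c x^i (y^(j+1) -
    y) of x^i y^j - c x^i vanishes at y = 0 and y = 1, and \<open>power_minus_power\<close> splits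
    off its bubble.\<close>
  define c where "c = 1 / (real j + 1)"
  have P: "(\<lambda>x y. - c * (\<Sum>m<j. x ^ i * y ^ m)) \<in> bipoly L (M - 1)"
    using monom by (intro bipoly_cmult bipoly_sum bipoly_monom) auto
  have T: "(\<lambda>x. c * x ^ i) \<in> unipoly L"
    using monom by (intro unipoly_cmult unipoly_monom) auto
  have "y * (1 - y) * (- c * (\<Sum>m<j. x ^ i * y ^ m)) = c * x ^ i * (y ^ Suc j - y)" for x y
  proof -
    have "y * (1 - y) * (- c * (\<Sum>m<j. x ^ i * y ^ m)) = - (c * x ^ i) * (y * (1 - y) * (\<Sum>m<j. y ^ m))"
      by (simp add: sum_distrib_left[symmetric])
    then show ?thesis
      unfolding power_minus_power by (simp add: algebra_simps)
  qed
  moreover have "deriv (\<lambda>y. c * x ^ i * (y ^ Suc j - y)) y = x ^ i * y ^ j - c * x ^ i" for x y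
  proof (rule DERIV_imp_deriv)
    have "c * (real j + 1) = 1"
      unfolding c_def by simp
    moreover have "c * x ^ i * ((1 + real j) * y ^ j - 1) = (c * (real j + 1)) * (x ^ i * y ^ j) - c * x ^ i"
      by (simp add: algebra_simps)
    ultimately have *: "c * x ^ i * ((1 + real j) * y ^ j - 1) = x ^ i * y ^ j - c * x ^ i"
      by simp
    show "((\<lambda>y. c * x ^ i * (y ^ Suc j - y)) has_real_derivative x ^ i * y ^ j - c * x ^ i) (at y)"
      by (rule derivative_eq_intros refl)+ (use * in \<open>simp add: mult.commute\<close>)
  qed
  ultimately show ?case
    by (intro bexI[OF _ P] bexI[OF _ T]) (simp add: dy_def)
next
  case (add f f')
  then obtain P T P' T' where
    1: "P \<in> bipoly L (M - 1)" "T \<in> unipoly L" "P' \<in> bipoly L (M - 1)" "T' \<in> unipoly L"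
    and 2: "\<And>x y. f x y = dy (\<lambda>x y. y * (1 - y) * P x y) x y + T x"
    "\<And>x y. f' x y = dy (\<lambda>x y. y * (1 - y) * P' x y) x y + T' x"
    by blast
  show ?case
    using dy_add[OF bipoly_ybubble[OF 1(1)] bipoly_ybubble[OF 1(3)]]
    by (intro bexI[OF _ bipoly_add[OF 1(1,3)]] bexI[OF _ unipoly_add[OF 1(2,4)]])
      (simp add: 2 distrib_left)
next
  case (cmult a f)
  then obtain P T where 1: "P \<in> bipoly L (M - 1)" "T \<in> unipoly L"
    and 2: "\<And>x y. f x y = dy (\<lambda>x y. y * (1 - y) * P x y) x y + T x"
    by blast
  have "(\<lambda>x y. y * (1 - y) * (a * P x y)) = (\<lambda>x y. a * (y * (1 - y) * P x y))"
    by (simp add: algebra_simps)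
  then show ?case
    using dy_cmult[OF bipoly_ybubble[OF 1(1)], of "\<lambda>_. a"]
    by (intro bexI[OF _ bipoly_cmult[OF 1(1), of a]] bexI[OF _ unipoly_cmult[OF 1(2), of a]])
      (simp add: 2 distrib_left)
qed

lemma bipoly_xprimitive:
  assumes "A \<in> bipoly L M"
  shows "\<exists>P\<in>bipoly (L - 1) M. \<exists>T\<in>unipoly M.
    \<forall>x y. A x y = dx (\<lambda>x y. x * (1 - x) * P x y) x y + T y"
proof -
  obtain P T where "P \<in> bipoly M (L - 1)" "T \<in> unipoly M"
    and "\<And>x y. A y x = dy (\<lambda>x y. y * (1 - y) * P x y) x y + T x"
    using bipoly_yprimitive[OF bipoly_swap[OF assms]] by blast
  then show ?thesis
    by (intro bexI[OF _ bipoly_swap] bexI[of _ T]) (auto simp: dy_def dx_def)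
qed

section \<open>Antiderivatives in z\<close>

text \<open>The numerator of an antiderivative in \<open>z\<close>: since
  \<open>(z\<^sup>h\<^sup>+\<^sup>1 / (1 + z)\<^sup>k\<^sup>+\<^sup>1)' = ((h + 1) z\<^sup>h + (h - k) z\<^sup>h\<^sup>+\<^sup>1) / (1 + z)\<^sup>k\<^sup>+\<^sup>2\<close>, the sum
  \<open>\<Sum>h<j. f h * z\<^sup>h\<^sup>+\<^sup>1 / (1 + z)\<^sup>k\<^sup>+\<^sup>1\<close> has derivative \<open>(\<Sum>h\<le>j. n h * z\<^sup>h) / (1 + z)\<^sup>k\<^sup>+\<^sup>2\<close>
  iff \<open>f = prim k n\<close> below \<open>j\<close> and \<open>prim k n j = 0\<close>.\<close>

fun prim :: "nat \<Rightarrow> (nat \<Rightarrow> real) \<Rightarrow> nat \<Rightarrow> real" where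
  "prim k n 0 = n 0"
| "prim k n (Suc h) = (n (Suc h) + (real k - real h) * prim k n h) / (real h + 2)"

text \<open>Everything except the last term is the numerator of a derivative, so
  \<open>prim k n j\<close> is the only obstruction. In the induction step the recursion of
  \<open>prim\<close> makes the coefficients of \<open>z ^ Suc j\<close> agree.\<close>

lemma prim_sum:
  "(\<Sum>h<Suc j. n h * z ^ h) =
    (\<Sum>h<j. prim k n h * ((real h + 1) * z ^ h + (real h - real k) * z ^ Suc h))
    + (real j + 1) * prim k n j * z ^ j"
proof (induction j)
  case (Suc j)
  have "n (Suc j) = (real j + 2) * prim k n (Suc j) - (real k - real j) * prim k n j"
    by simp
  show ?case
    unfolding sum.lessThan_Suc[of _ "Suc j"] Suc \<open>n (Suc j) = _\<close>
    by (simp del: prim.simps add: algebra_simps)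
qed simp

lemma prim_add: "prim k (\<lambda>h. n h + n' h) j = prim k n j + prim k n' j"
  by (induction j) (simp_all add: add_divide_distrib distrib_left)

lemma prim_cmult: "prim k (\<lambda>h. a * n h) j = a * prim k n j"
  by (induction j) (simp_all add: algebra_simps)

lemma prim_diff: "prim k (\<lambda>h. n h - n' h) j = prim k n j - prim k n' j"
  using prim_add[of k n "\<lambda>h. - 1 * n' h"] unfolding prim_cmult by simp

lemma prim_nonneg: "(\<And>h. n h \<ge> 0) \<Longrightarrow> j \<le> k \<Longrightarrow> prim k n j \<ge> 0"
  by (induction j) auto

text \<open>As long as \<open>j \<le> k\<close>, the factors \<open>real k - real h\<close> in the
  recursion are positive, so one positive entry propagates upwards. This makes the constants
  \<open>al\<close> and \<open>be\<close> below invertible.\<close>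

lemma prim_pos:
  assumes n: "\<And>h. n h \<ge> 0" and "i \<le> j" "j \<le> k" "n i > 0"
  shows "prim k n j > 0"
  using assms(2,3)
proof (induction rule: dec_induct)
  case base
  then show ?case
  proof (cases i)
    case (Suc i')
    then show ?thesis
      using assms(4) prim_nonneg[of n i' k] base n
      by (simp add: add_pos_nonneg)
  qed (use assms(4) in simp)
next
  case (step j)
  then show ?case
    using n[of "Suc j"] by (auto intro!: divide_pos_pos add_nonneg_pos)
qed

lemma prim_bipoly:
  "(\<And>h. n h \<in> bipoly L M) \<Longrightarrow> (\<lambda>x y. prim k (\<lambda>h. n h x y) j) \<in> bipoly L M"
  by (induction j) (auto intro!: bipoly_divide bipoly_add bipoly_cmult)

section \<open>Transport between the two pyramids\<close>

text \<open>The inverse of \<open>phi\<close> off the plane \<open>p$3 = 1\<close>, which meets the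
  pyramid only in the apex.\<close>

definition psi :: "real^3 \<Rightarrow> real^3" where
  "psi p = vector [p$1 / (1 - p$3), p$2 / (1 - p$3), p$3 / (1 - p$3)]"

text \<open>The 1-form pullback by \<open>psi\<close> in coordinates: the transposed Jacobian of
  \<open>psi\<close> at \<open>p\<close> applied to \<open>W (psi p)\<close>, where
  \<open>l = 1 / (1 - p$3)\<close>.\<close>

definition push1_field :: "(real^3 \<Rightarrow> real^3) \<Rightarrow> real^3 \<Rightarrow> real^3" where
  "push1_field W p = (let q = psi p; l = 1 + q$3 in
     vector [l * W q$1, l * W q$2, l ^ 2 * W q$3 + q$1 * l * W q$1 + q$2 * l * W q$2])"

text \<open>The 2-form pullback by \<open>psi\<close>: the determinant \<open>l ^ 4\<close> of its
  Jacobian times the inverse Jacobian, applied to \<open>u (psi p)\<close>.\<close>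

definition push2_field :: "(real^3 \<Rightarrow> real^3) \<Rightarrow> real^3 \<Rightarrow> real^3" where
  "push2_field u p = (let q = psi p; l = 1 + q$3 in
     vector [l ^ 3 * u q$1 - q$1 * l ^ 2 * u q$3, l ^ 3 * u q$2 - q$2 * l ^ 2 * u q$3, l ^ 2 * u q$3])"

lemma psi_phi: "q \<in> inf_pyramid \<Longrightarrow> psi (phi q) = q"
  by (simp add: psi_def phi_def inf_pyramid_def vec_eq_iff forall_3 divide_simps)

lemma pyramid_height:
  assumes "p \<in> pyramid - {apex}"
  shows "p$3 < 1"
proof (rule ccontr)
  assume "\<not> p$3 < 1"
  then have "p$1 = 0 \<and> p$2 = 0 \<and> p$3 = 1"
    using assms by (auto simp: pyramid_def)
  then have "p = apex"
    by (simp add: apex_def vec_eq_iff forall_3)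
  then show False
    using assms by simp
qed

lemma phi_psi: "p$3 < 1 \<Longrightarrow> phi (psi p) = p"
  by (simp add: psi_def phi_def vec_eq_iff forall_3 divide_simps)

lemma psi_in_inf_pyramid: "p \<in> pyramid \<Longrightarrow> p$3 < 1 \<Longrightarrow> psi p \<in> inf_pyramid"
  by (simp add: psi_def pyramid_def inf_pyramid_def)

lemma phi_in_pyramid: "q \<in> inf_pyramid \<Longrightarrow> phi q \<in> pyramid - {apex}"
  by (auto simp: phi_def pyramid_def inf_pyramid_def apex_def vec_eq_iff forall_3 divide_simps)

section \<open>Jacobians of the coordinate maps and explicit pullbacks\<close>

lemma has_derivative_vec3:
  fixes f :: "'a::real_normed_vector \<Rightarrow> real^3"
  assumes "((\<lambda>p. f p$1) has_derivative (\<lambda>d. D d$1)) (at a within S)"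
    "((\<lambda>p. f p$2) has_derivative (\<lambda>d. D d$2)) (at a within S)"
    "((\<lambda>p. f p$3) has_derivative (\<lambda>d. D d$3)) (at a within S)"
  shows "(f has_derivative D) (at a within S)"
proof -
  have "((\<lambda>p. f p $ i) has_derivative (\<lambda>d. D d $ i)) (at a within S)" for i
    using assms exhaust_3[of i] by auto
  then show ?thesis
    by (subst has_derivative_componentwise_within) (auto simp: Basis_vec_def inner_axis)
qed

lemma has_derivative_vec_nth: "((\<lambda>p. p$i) has_derivative (\<lambda>d. d$i)) F"
  by (intro bounded_linear_imp_has_derivative bounded_linear_vec_nth)

lemma has_derivative_phi:
  assumes "1 + q$3 \<noteq> 0"
  shows "(phi has_derivative (\<lambda>d. vector [(d$1 - phi q$1 * d$3) / (1 + q$3),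
    (d$2 - phi q$2 * d$3) / (1 + q$3), d$3 / (1 + q$3) ^ 2])) (at q)"
  using assms
  by (intro has_derivative_vec3; simp add: phi_def)
    (auto intro!: derivative_eq_intros has_derivative_vec_nth simp: field_simps power2_eq_square)

lemma has_derivative_psi:
  assumes "p$3 \<noteq> 1"
  shows "(psi has_derivative (\<lambda>d. vector [(1 + psi p$3) * (d$1 + psi p$1 * d$3),
    (1 + psi p$3) * (d$2 + psi p$2 * d$3), (1 + psi p$3) ^ 2 * d$3])) (at p)"
proof -
  have "1 - p$3 \<noteq> 0"
    using assms by simp
  then show ?thesis
    by (intro has_derivative_vec3; simp add: psi_def)
      (auto intro!: derivative_eq_intros has_derivative_vec_nth simp: field_simps power2_eq_square)
qed

lemma jacobian_at:
  assumes "(f has_derivative D) (at p)"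
  shows "jacobian f (at p) = matrix D"
  using frechet_derivative_at[OF assms] by (simp add: jacobian_def)

lemma jacobian_phi:
  assumes "1 + q$3 \<noteq> 0"
  shows "jacobian phi (at q) = vector [
    vector [1 / (1 + q$3), 0, - phi q$1 / (1 + q$3)],
    vector [0, 1 / (1 + q$3), - phi q$2 / (1 + q$3)],
    vector [0, 0, 1 / (1 + q$3) ^ 2]]"
  unfolding jacobian_at[OF has_derivative_phi[OF assms]]
  by (simp add: matrix_def vec_eq_iff forall_3 axis_def)

lemma pullback1_phi:
  assumes "1 + q$3 \<noteq> 0"
  shows "pullback1 phi E q = (let e = E (phi q); l = 1 + q$3 in
    vector [e$1 / l, e$2 / l, (e$3 - q$1 * e$1 - q$2 * e$2) / l ^ 2])"
proof -
  define l where "l = 1 + q$3"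
  have *: "q$1 = l * phi q$1" "q$2 = l * phi q$2" "1 + q$3 = l" "l \<noteq> 0"
    using assms by (simp_all add: phi_def l_def)
  show ?thesis
    unfolding pullback1_def jacobian_phi[OF assms] using *
    by (simp add: matrix_vector_mult_def transpose_def vec_eq_iff forall_3 sum_3 Let_def
        field_simps power2_eq_square)
qed

lemma matrix_inv_eqI:
  fixes A B :: "real^'n^'n"
  assumes "A ** B = mat 1" "B ** A = mat 1"
  shows "matrix_inv A = B"
  unfolding matrix_inv_def
proof (rule some_equality)
  show "C = B" if "A ** C = mat 1 \<and> C ** A = mat 1" for C
    using that assms(2) by (metis matrix_mul_assoc matrix_mul_lid matrix_mul_rid)
qed (use assms in blast)

lemma pullback2_phi:
  assumes "1 + q$3 \<noteq> 0"
  shows "pullback2 phi v q = (let e = v (phi q); l = 1 + q$3 in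
    vector [(e$1 + q$1 * e$3) / l ^ 3, (e$2 + q$2 * e$3) / l ^ 3, e$3 / l ^ 2])"
proof -
  define l where "l = 1 + q$3"
  have l: "phi q$1 = q$1 / l" "phi q$2 = q$2 / l" "1 + q$3 = l" "l \<noteq> 0"
    using assms by (simp_all add: phi_def l_def)
  \<comment> \<open>\<open>B\<close> is the Jacobian of \<open>psi\<close> at \<open>phi q\<close>,
    hence the candidate for the inverse.\<close>
  define B :: "real^3^3" where
    "B = vector [vector [l, 0, q$1 * l], vector [0, l, q$2 * l], vector [0, 0, l ^ 2]]"
  let ?J = "jacobian phi (at q)"
  have "?J ** B = mat 1" "B ** ?J = mat 1"
    unfolding jacobian_phi[OF assms] B_def using l
    by (simp_all add: matrix_matrix_mult_def mat_def vec_eq_iff forall_3 sum_3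
        field_simps power2_eq_square)
  then have inv: "matrix_inv ?J = B"
    by (rule matrix_inv_eqI)
  have det: "det ?J = 1 / l ^ 4"
    unfolding jacobian_phi[OF assms] using l
    by (simp add: det_3 field_simps eval_nat_numeral)
  show ?thesis
    unfolding pullback2_def inv det B_def using l
    by (simp add: matrix_vector_mult_def vec_eq_iff forall_3 sum_3 Let_def
      field_simps eval_nat_numeral)
qed

section \<open>Explicit inverses of the pullbacks\<close>

lemma push1_field_in_push1: "W \<in> U \<Longrightarrow> push1_field W \<in> push1 U"
  unfolding push1_def
  by (auto intro!: bexI[of _ W] simp: pullback1_phi inf_pyramid_def psi_phi push1_field_def Let_def
      vec_eq_iff forall_3 power2_eq_square)

lemma pullback2_push2_field: "q \<in> inf_pyramid \<Longrightarrow> pullback2 phi (push2_field u) q = u q"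
  by (subst pullback2_phi)
    (auto simp: inf_pyramid_def psi_phi push2_field_def Let_def vec_eq_iff forall_3
      power3_eq_cube power2_eq_square)

lemma push2_field_in_push2: "u \<in> U \<Longrightarrow> push2_field u \<in> push2 U"
  unfolding push2_def using pullback2_push2_field by blast

lemma push2_field_pullback2:
  assumes "p \<in> pyramid - {apex}"
  shows "push2_field (pullback2 phi v) p = v p"
proof -
  have p: "p$3 < 1" using pyramid_height[OF assms] .
  define l where "l = 1 + psi p$3"
  have l: "1 + psi p$3 \<noteq> 0"
    using p by (simp add: psi_def field_simps)
  then show ?thesis
    unfolding push2_field_def pullback2_phi[OF l] phi_psi[OF p] Let_def l_def[symmetric]
    by (simp add: vec_eq_iff forall_3)
qed

section \<open>Derivatives within the closed pyramid and the curl\<close>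

lemma has_derivative_within_convex_unique:
  fixes f :: "'a::real_normed_vector \<Rightarrow> 'b::real_normed_vector"
  assumes S: "convex S" "p \<in> S" "y \<in> S"
    and D: "(f has_derivative D) (at p within S)" "(f has_derivative D') (at p within S)"
  shows "D (y - p) = D' (y - p)"
proof -
  \<comment> \<open>By convexity the segment from \<open>p\<close> to \<open>y\<close> stays in
    \<open>S\<close>. Along it uniqueness is the one-variable statement at an endpoint of [0, 1],
    valid even if \<open>p\<close> is a boundary point of \<open>S\<close>.\<close>
  define c where "c t = p + t *\<^sub>R (y - p)" for t
  have c: "(c has_derivative (\<lambda>t. t *\<^sub>R (y - p))) (at 0 within {0..1})"
    unfolding c_def by (auto intro!: derivative_eq_intros)
  have sub: "c ` {0..1} \<subseteq> S"
  proof
    fix x assume "x \<in> c ` {0..1}"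
    then obtain t where "t \<in> {0..1}" "x = (1 - t) *\<^sub>R p + t *\<^sub>R y"
      by (auto simp: c_def algebra_simps)
    then show "x \<in> S"
      using convexD_alt[OF S] by simp
  qed
  have *: "((f \<circ> c) has_vector_derivative E (y - p)) (at 0 within {0..1})"
    if "(f has_derivative E) (at p within S)" for E
  proof -
    have "(f has_derivative E) (at (c 0) within c ` {0..1})"
      using has_derivative_subset[OF that sub] by (simp add: c_def)
    from diff_chain_within[OF c this] show ?thesis
      using linear_simps(5)[OF has_derivative_bounded_linear[OF that]]
      by (simp add: has_vector_derivative_def comp_def)
  qed
  show ?thesis
    by (rule vector_derivative_unique_within_closed_interval[of 0 1 0])
      (use *[OF D(1)] *[OF D(2)] in auto)
qed

lemma convex_pyramid: "convex pyramid"
proof -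
  have eq: "pyramid = {p. vector [1, 0, 0] \<bullet> p \<ge> 0} \<inter> {p. vector [0, 1, 0] \<bullet> p \<ge> 0} \<inter>
      {p. vector [0, 0, 1] \<bullet> p \<ge> 0} \<inter> {p. vector [1, 0, 1] \<bullet> p \<le> 1} \<inter>
      {p. vector [0, 1, 1] \<bullet> p \<le> 1}"
    by (auto simp: pyramid_def inner_vec_def sum_3)
  show ?thesis
    unfolding eq by (intro convex_Int convex_halfspace_le convex_halfspace_ge)
qed

text \<open>\<open>frechet_derivative\<close> is a choice, so its uniqueness must be shown, also at
  boundary points. Two derivatives within the pyramid agree on differences of its points, and these
  include the three unit vectors: the origin and \<open>axis i 1\<close> all belong to the
  pyramid.\<close>

lemma jacobian_within_pyramid:
  assumes D: "(f has_derivative D) (at p)" and p: "p \<in> pyramid"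
  shows "jacobian f (at p within pyramid) = matrix D"
proof -
  let ?D' = "frechet_derivative f (at p within pyramid)"
  have D: "(f has_derivative D) (at p within pyramid)"
    using D by (rule has_derivative_at_withinI)
  then have D': "(f has_derivative ?D') (at p within pyramid)"
    using frechet_derivative_works differentiable_def by blast
  interpret D: linear D using D by (rule has_derivative_linear)
  interpret D': linear ?D' using D' by (rule has_derivative_linear)
  have *: "?D' (y - y') = D (y - y')" if "y \<in> pyramid" "y' \<in> pyramid" for y y'
  proof -
    have "?D' ((y - p) - (y' - p)) = D ((y - p) - (y' - p))"
      unfolding D.diff[of "y - p" "y' - p"] D'.diff[of "y - p" "y' - p"]
      using that by (simp only: has_derivative_within_convex_unique[OF convex_pyramid p _ D' D])
    then show ?thesis by simp
  qed
  have "?D' (axis i 1) = D (axis i 1)" for i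
    using *[of "axis i 1" 0] exhaust_3[of i] by (auto simp: pyramid_def axis_def)
  then show ?thesis
    by (simp add: jacobian_def matrix_def)
qed

text \<open>Pullbacks commute with the exterior derivative: the second derivatives of
  \<open>psi\<close> are symmetric and cancel in the antisymmetric combinations that form the curl.
  A constant field suffices on the right because \<open>push2_field\<close> uses only the value at
  \<open>psi p\<close>.\<close>

lemma curl_push1_field:
  fixes W :: "real^3 \<Rightarrow> real^3"
  assumes p: "p \<in> pyramid - {apex}"
    and W: "((\<lambda>q. W q$1) has_derivative (\<lambda>d. a1 * d$1 + a2 * d$2 + a3 * d$3)) (at (psi p))"
      "((\<lambda>q. W q$2) has_derivative (\<lambda>d. b1 * d$1 + b2 * d$2 + b3 * d$3)) (at (psi p))"
      "((\<lambda>q. W q$3) has_derivative (\<lambda>d. c1 * d$1 + c2 * d$2 + c3 * d$3)) (at (psi p))"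
  shows "curl_on pyramid (push1_field W) p =
    push2_field (\<lambda>q. vector [c2 - b3, a3 - c1, b1 - a2]) p"
proof -
  have p3: "p$3 \<noteq> 1"
    using pyramid_height[OF p] by simp
  define q l where "q = psi p" and "l = 1 + q$3"
  define \<psi>' :: "real^3 \<Rightarrow> real^3" where
    "\<psi>' = (\<lambda>d. vector [l * (d$1 + q$1 * d$3), l * (d$2 + q$2 * d$3), l ^ 2 * d$3])"
  have psi: "(psi has_derivative \<psi>') (at p)"
    using has_derivative_psi[OF p3] by (simp add: \<psi>'_def q_def l_def)
  have psi_nth: "((\<lambda>p. psi p$i) has_derivative (\<lambda>d. \<psi>' d$i)) (at p)" for i
    by (rule has_derivative_compose[OF psi has_derivative_vec_nth])
  note W' = W[THEN has_derivative_compose[OF psi]]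
  define D1 where "D1 d = l * (a1 * \<psi>' d$1 + a2 * \<psi>' d$2 + a3 * \<psi>' d$3) + \<psi>' d$3 * W q$1" for d
  define D2 where "D2 d = l * (b1 * \<psi>' d$1 + b2 * \<psi>' d$2 + b3 * \<psi>' d$3) + \<psi>' d$3 * W q$2" for d
  define D3 where "D3 d = l ^ 2 * (c1 * \<psi>' d$1 + c2 * \<psi>' d$2 + c3 * \<psi>' d$3) + 2 * l * \<psi>' d$3 * W q$3
    + q$1 * D1 d + \<psi>' d$1 * (l * W q$1) + q$2 * D2 d + \<psi>' d$2 * (l * W q$2)" for d
  have 1: "((\<lambda>p. (1 + psi p$3) * W (psi p)$1) has_derivative D1) (at p)"
    by (rule has_derivative_eq_rhs, (rule derivative_intros psi_nth W')+)
      (auto simp: fun_eq_iff D1_def q_def[symmetric] l_def algebra_simps)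
  have 2: "((\<lambda>p. (1 + psi p$3) * W (psi p)$2) has_derivative D2) (at p)"
    by (rule has_derivative_eq_rhs, (rule derivative_intros psi_nth W')+)
      (auto simp: fun_eq_iff D2_def q_def[symmetric] l_def algebra_simps)
  have 3: "((\<lambda>p. (1 + psi p$3) ^ 2 * W (psi p)$3 + psi p$1 * ((1 + psi p$3) * W (psi p)$1)
      + psi p$2 * ((1 + psi p$3) * W (psi p)$2)) has_derivative D3) (at p)"
    by (rule has_derivative_eq_rhs, (rule derivative_intros psi_nth W' 1 2)+)
      (auto simp: fun_eq_iff D3_def q_def[symmetric] l_def algebra_simps)
  have "(push1_field W has_derivative (\<lambda>d. vector [D1 d, D2 d, D3 d])) (at p)"
    using 1 2 3 by (intro has_derivative_vec3) (simp_all add: push1_field_def Let_def mult.assoc)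
  then have J: "jacobian (push1_field W) (at p within pyramid) = matrix (\<lambda>d. vector [D1 d, D2 d, D3 d])"
    using p by (intro jacobian_within_pyramid) auto
  show ?thesis
    unfolding curl_on_def J push2_field_def q_def[symmetric] Let_def l_def[symmetric]
    by (simp add: matrix_def vec_eq_iff forall_3 D1_def D2_def D3_def \<psi>'_def axis_def
        algebra_simps eval_nat_numeral)
qed

section \<open>Decomposition on the infinite pyramid\<close>

definition U1_inf_curl :: "nat \<Rightarrow> (real^3 \<Rightarrow> real^3) set" where
  "U1_inf_curl k = {field3
      (\<lambda>x y z. y * (1 - y) * z * q1 x y z)
      (\<lambda>x y z. x * (1 - x) * z * q2 x y z)
      (\<lambda>x y z. x * (1 - x) * y * (1 - y) * \<rho> x y z) | q1 q2 \<rho>.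
        q1 \<in> rat_Q (k + 1) (int k - 1) (int k - 2) (int k - 2) \<and>
        q2 \<in> rat_Q (k + 1) (int k - 2) (int k - 1) (int k - 2) \<and>
        \<rho> \<in> rat_Q (k + 1) (int k - 2) (int k - 2) 0}"

definition U2_inf_div :: "nat \<Rightarrow> (real^3 \<Rightarrow> real^3) set" where
  "U2_inf_div k = {field3
      (\<lambda>x y z. z ^ (k - 1) / (1 + z) ^ (k + 2) * (dy r x y + 2 * t x y))
      (\<lambda>x y z. z ^ (k - 1) / (1 + z) ^ (k + 2) * (dx r x y + 2 * s x y))
      (\<lambda>x y z. z ^ (k - 1) / (1 + z) ^ (k + 2) *
                 ((1 + z) * (dy (dx r) x y + dy s x y + dx t x y))
               + z * \<chi>3 x y z) | r s t \<chi>3.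
        (\<exists>p \<in> poly_Q2 (int k - 2) (int k - 2).
           r = (\<lambda>x y. x * (1 - x) * y * (1 - y) * p x y)) \<and>
        (\<exists>t' \<in> poly_P1 (int k - 2). t = (\<lambda>x y. x * (1 - x) * t' x)) \<and>
        (\<exists>s' \<in> poly_P1 (int k - 2). s = (\<lambda>x y. y * (1 - y) * s' y)) \<and>
        \<chi>3 \<in> rat_Q (k + 2) (int k - 1) (int k - 1) (int k - 2)}"

lemma U1_0_curl_eq: "U1_0_curl k = push1 (U1_inf_curl k)"
  by (simp only: U1_0_curl_def U1_inf_curl_def)

lemma U2_0_div_eq: "U2_0_div k = push2 (U2_inf_div k)"
  by (simp only: U2_0_div_def U2_inf_div_def)

section \<open>Numerators of the rational fields\<close>

lemma rat_Q_iff: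
  "f \<in> rat_Q d l m n \<longleftrightarrow>
    (\<exists>F. (\<forall>h. F h \<in> bipoly (nat (l + 1)) (nat (m + 1))) \<and>
         f = (\<lambda>x y z. (\<Sum>h<nat (n + 1). F h x y * z ^ h) / (1 + z) ^ d))" (is "_ \<longleftrightarrow> ?R")
proof
  show "f \<in> rat_Q d l m n \<Longrightarrow> ?R"
    unfolding rat_Q_def by (auto simp: poly_Q3_iff)
  assume ?R
  then obtain F where "\<And>h. F h \<in> bipoly (nat (l + 1)) (nat (m + 1))"
    and f: "f = (\<lambda>x y z. (\<Sum>h<nat (n + 1). F h x y * z ^ h) / (1 + z) ^ d)"
    by blast
  then have "(\<lambda>x y z. \<Sum>h<nat (n + 1). F h x y * z ^ h) \<in> poly_Q3 l m n"
    unfolding poly_Q3_iff by blast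
  then show "f \<in> rat_Q d l m n"
    unfolding rat_Q_def f mem_Collect_eq
    by (intro exI[of _ "\<lambda>x y z. \<Sum>h<nat (n + 1). F h x y * z ^ h"] conjI refl)
qed

text \<open>The numerators of \<open>a\<close> and \<open>b\<close> stop below \<open>z ^ n\<close>,
  so the coefficients of \<open>z ^ n\<close> in the first two components are \<open>2 * t\<close>
  and \<open>2 * s\<close>. Hence the extra term of the third component is determined by
  \<open>A n\<close> and \<open>B n\<close>, and \<open>s\<close>, \<open>t\<close> can be
  eliminated.\<close>

lemma U2_inf_numerators:
  assumes "u \<in> U2_inf (Suc n)"
  obtains A B C where
    "\<And>h. A h \<in> bipoly (Suc (Suc n)) (Suc n)" "\<And>h. B h \<in> bipoly (Suc n) (Suc (Suc n))"
    "\<And>h. C h \<in> bipoly (Suc n) (Suc n)"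
    "\<And>q. u q$1 = (\<Sum>h<Suc n. A h (q$1) (q$2) * q$3 ^ h) / (1 + q$3) ^ (Suc n + 2)"
    "\<And>q. u q$2 = (\<Sum>h<Suc n. B h (q$1) (q$2) * q$3 ^ h) / (1 + q$3) ^ (Suc n + 2)"
    "\<And>q. u q$3 = ((\<Sum>h<Suc n. C h (q$1) (q$2) * q$3 ^ h) +
      q$3 ^ n * (1 + q$3) * ((dx (A n) (q$1) (q$2) + dy (B n) (q$1) (q$2)) / 2)) / (1 + q$3) ^ (Suc n + 2)"
proof -
  obtain a b c s t where
    a: "a \<in> rat_Q (Suc n + 2) (int (Suc n)) (int (Suc n) - 1) (int (Suc n) - 2)" and
    b: "b \<in> rat_Q (Suc n + 2) (int (Suc n) - 1) (int (Suc n)) (int (Suc n) - 2)" and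
    c: "c \<in> rat_Q (Suc n + 2) (int (Suc n) - 1) (int (Suc n) - 1) (int (Suc n) - 1)" and
    s: "s \<in> poly_Q2 (int (Suc n) - 1) (int (Suc n))" and
    t: "t \<in> poly_Q2 (int (Suc n)) (int (Suc n) - 1)" and
    u: "u = (\<lambda>p. field3 a b c p
          + field3 (\<lambda>x y z. 0)
                   (\<lambda>x y z. z ^ (Suc n - 1) / (1 + z) ^ (Suc n + 2) * (2 * s x y))
                   (\<lambda>x y z. z ^ (Suc n - 1) / (1 + z) ^ (Suc n + 2) * (dy s x y * (1 + z))) p
          + field3 (\<lambda>x y z. z ^ (Suc n - 1) / (1 + z) ^ (Suc n + 2) * (2 * t x y))
                   (\<lambda>x y z. 0)
                   (\<lambda>x y z. z ^ (Suc n - 1) / (1 + z) ^ (Suc n + 2) * (dx t x y * (1 + z))) p)"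
    using assms unfolding U2_inf_def by blast
  have nats: "nat (int (Suc n) + 1) = Suc (Suc n)" "nat (int (Suc n) - 1 + 1) = Suc n"
    "nat (int (Suc n) - 2 + 1) = n"
    by auto
  obtain a' where a': "\<And>h. a' h \<in> bipoly (Suc (Suc n)) (Suc n)"
    and a: "a = (\<lambda>x y z. (\<Sum>h<n. a' h x y * z ^ h) / (1 + z) ^ (Suc n + 2))"
    using a unfolding rat_Q_iff nats by blast
  obtain b' where b': "\<And>h. b' h \<in> bipoly (Suc n) (Suc (Suc n))"
    and b: "b = (\<lambda>x y z. (\<Sum>h<n. b' h x y * z ^ h) / (1 + z) ^ (Suc n + 2))"
    using b unfolding rat_Q_iff nats by blast
  obtain c' where c': "\<And>h. c' h \<in> bipoly (Suc n) (Suc n)"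
    and c: "c = (\<lambda>x y z. (\<Sum>h<Suc n. c' h x y * z ^ h) / (1 + z) ^ (Suc n + 2))"
    using c unfolding rat_Q_iff nats by blast
  have s: "s \<in> bipoly (Suc n) (Suc (Suc n))" and t: "t \<in> bipoly (Suc (Suc n)) (Suc n)"
    using s t unfolding poly_Q2_bipoly nats by auto
  define A where "A h = (if h < n then a' h else (\<lambda>x y. 2 * t x y))" for h
  define B where "B h = (if h < n then b' h else (\<lambda>x y. 2 * s x y))" for h
  have An: "A n = (\<lambda>x y. 2 * t x y)" and Bn: "B n = (\<lambda>x y. 2 * s x y)"
    by (simp_all add: A_def B_def)
  have sA: "(\<Sum>h<Suc n. A h x y * z ^ h) = (\<Sum>h<n. a' h x y * z ^ h) + 2 * t x y * z ^ n" for x y z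
    by (simp add: A_def)
  have sB: "(\<Sum>h<Suc n. B h x y * z ^ h) = (\<Sum>h<n. b' h x y * z ^ h) + 2 * s x y * z ^ n" for x y z
    by (simp add: B_def)
  have d: "dx (A n) x y = 2 * dx t x y" "dy (B n) x y = 2 * dy s x y" for x y
    unfolding An Bn by (rule dx_cmult[OF t] dy_cmult[OF s])+
  show thesis
  proof (rule that[of A B c'])
    show "u q$1 = (\<Sum>h<Suc n. A h (q$1) (q$2) * q$3 ^ h) / (1 + q$3) ^ (Suc n + 2)"
      "u q$2 = (\<Sum>h<Suc n. B h (q$1) (q$2) * q$3 ^ h) / (1 + q$3) ^ (Suc n + 2)"
      "u q$3 = ((\<Sum>h<Suc n. c' h (q$1) (q$2) * q$3 ^ h) +
        q$3 ^ n * (1 + q$3) * ((dx (A n) (q$1) (q$2) + dy (B n) (q$1) (q$2)) / 2)) /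
        (1 + q$3) ^ (Suc n + 2)" for q
      unfolding u a b c sA sB d
      by (simp_all only: field3_def vector_add_component vector_3 diff_Suc_1 add_divide_distrib)
        (simp_all add: add_divide_distrib algebra_simps)
  qed (auto simp: A_def B_def intro: a' b' c' bipoly_cmult s t)
qed

section \<open>Solving for the first two components\<close>

lemma sum_first_two: "(\<Sum>h<Suc (Suc m). (if h < 2 then 1 else 0) * z ^ h) = 1 + (z::real)"
proof -
  have "(\<Sum>h<Suc (Suc m). (if h < 2 then 1 else 0) * z ^ h) = (\<Sum>h\<in>{0, 1}. z ^ h)"
    by (rule sum.mono_neutral_cong_right) auto
  then show ?thesis by simp
qed

lemma sum_last: "(\<Sum>h<Suc n. (if h = n then 1 else 0) * z ^ h) = (z::real) ^ n"
proof -
  have "(\<Sum>h<Suc n. (if h = n then 1 else 0) * z ^ h) = (\<Sum>h\<in>{n}. z ^ h)"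
    by (rule sum.mono_neutral_cong_right) auto
  then show ?thesis by simp
qed

text \<open>For \<open>k = Suc (Suc m)\<close> the last recursion factor
  \<open>real k - real m\<close> equals 2. A vanishing obstruction therefore ties the top
  coefficient of the integrand to that of the antiderivative.\<close>

lemma prim_exact:
  assumes "prim k n (Suc m) = 0" "k = Suc (Suc m)"
  shows "(\<Sum>h<Suc (Suc m). n h * z ^ h) =
      (\<Sum>h<Suc m. prim k n h * ((real h + 1) * z ^ h + (real h - real k) * z ^ Suc h))"
    and "n (Suc m) = - 2 * prim k n m"
  using prim_sum[of n z "Suc m" k] assms by (auto simp: divide_eq_0_iff)

text \<open>The solvability conditions determine \<open>p\<close>, \<open>R0\<close>,
  \<open>t0\<close>, \<open>s0\<close>; then \<open>prim\<close> supplies \<open>f1\<close> and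
  \<open>f2\<close>. The factor \<open>1 + z\<close> appears because \<open>R0\<close> stands over
  \<open>(1 + z) ^ (k + 1)\<close>, one power below the common denominator. The last two equations
  record top coefficients for use in the third component.\<close>

lemma horizontal_decomposition:
  assumes A: "\<And>h. A h \<in> bipoly (Suc m) (Suc (Suc m))"
    and B: "\<And>h. B h \<in> bipoly (Suc (Suc m)) (Suc m)"
    and k: "k = Suc (Suc m)"
  obtains f1 f2 R0 p t0 s0 where
    "\<And>h. f1 h \<in> bipoly (Suc (Suc m)) (Suc m)" "\<And>h. f2 h \<in> bipoly (Suc m) (Suc (Suc m))"
    "R0 \<in> bipoly (Suc m) (Suc m)" "p \<in> bipoly (Suc m) (Suc m)"
    "t0 \<in> unipoly (Suc m)" "s0 \<in> unipoly (Suc m)"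
    "\<And>x y z. (\<Sum>h<Suc (Suc m). A h x y * z ^ h) = (1 + z) * dy (\<lambda>x y. y * (1 - y) * R0 x y) x y
      - (\<Sum>h<Suc m. f2 h x y * ((real h + 1) * z ^ h + (real h - real k) * z ^ Suc h))
      + z ^ Suc m * (dy (\<lambda>x y. y * (1 - y) * p x y) x y + 2 * t0 x)"
    "\<And>x y z. (\<Sum>h<Suc (Suc m). B h x y * z ^ h) =
      (\<Sum>h<Suc m. f1 h x y * ((real h + 1) * z ^ h + (real h - real k) * z ^ Suc h))
      - (1 + z) * dx (\<lambda>x y. x * (1 - x) * R0 x y) x y
      + z ^ Suc m * (dx (\<lambda>x y. x * (1 - x) * p x y) x y + 2 * s0 y)"
    "\<And>x y. 2 * f2 m x y = A (Suc m) x y - of_bool (m = 0) * dy (\<lambda>x y. y * (1 - y) * R0 x y) x y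
      - dy (\<lambda>x y. y * (1 - y) * p x y) x y - 2 * t0 x"
    "\<And>x y. 2 * f1 m x y = - B (Suc m) x y - of_bool (m = 0) * dx (\<lambda>x y. x * (1 - x) * R0 x y) x y
      + dx (\<lambda>x y. x * (1 - x) * p x y) x y + 2 * s0 y"
proof -
  \<comment> \<open>The coefficients of \<open>1 + z\<close> and of \<open>z ^ Suc m\<close>, the
    powers of \<open>z\<close> that accompany \<open>R0\<close> and the terms in \<open>p\<close>,
    \<open>t0\<close>, \<open>s0\<close>.\<close>
  define low where "low h = (if h < 2 then 1 else 0 :: real)" for h :: nat
  define top where "top h = (if h = Suc m then 1 else 0 :: real)" for h
  \<comment> \<open>Up to a common factor, \<open>al\<close> and \<open>be\<close> are the integrals of \<open>z\<^sup>k\<^sup>-\<^sup>1 / (1 + z)\<^sup>k\<^sup>+\<^sup>2\<close>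
    and \<open>1 / (1 + z)\<^sup>k\<^sup>+\<^sup>1\<close> over \<open>z \<ge> 0\<close>.\<close>
  define al where "al = prim k top (Suc m)"
  define be where "be = prim k low (Suc m)"
  have al: "al > 0" unfolding al_def
    by (rule prim_pos[of _ "Suc m"]) (auto simp: top_def k)
  have be: "be > 0" unfolding be_def
    by (rule prim_pos[of _ 0]) (auto simp: low_def k)
  obtain P1 T1 where P1: "P1 \<in> bipoly (Suc m) (Suc m)" and T1: "T1 \<in> unipoly (Suc m)"
    and A_eq: "\<And>x y. prim k (\<lambda>h. A h x y) (Suc m) = dy (\<lambda>x y. y * (1 - y) * P1 x y) x y + T1 x"
    using bipoly_yprimitive[OF prim_bipoly[of A, OF A], of k "Suc m"] unfolding diff_Suc_1 by blast
  obtain P2 T2 where P2: "P2 \<in> bipoly (Suc m) (Suc m)" and T2: "T2 \<in> unipoly (Suc m)"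
    and B_eq: "\<And>x y. prim k (\<lambda>h. B h x y) (Suc m) = dx (\<lambda>x y. x * (1 - x) * P2 x y) x y + T2 y"
    using bipoly_xprimitive[OF prim_bipoly[of B, OF B], of k "Suc m"] unfolding diff_Suc_1 by blast
  \<comment> \<open>Solves P1 = al p + be R0 and P2 = al p - be R0. The signs differ since the third
    potential enters the curl through its \<open>y\<close> derivative and minus its \<open>x\<close>
    derivative, whereas both derivatives of \<open>r\<close> enter with a plus.\<close>
  define p where "p x y = (P1 x y + P2 x y) / (2 * al)" for x y
  define R0 where "R0 x y = (P1 x y - P2 x y) / (2 * be)" for x y
  define t0 where "t0 x = T1 x / (2 * al)" for x
  define s0 where "s0 x = T2 x / (2 * al)" for x
  have p: "p \<in> bipoly (Suc m) (Suc m)" and R0: "R0 \<in> bipoly (Suc m) (Suc m)"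
    unfolding p_def[abs_def] R0_def[abs_def] by (intro bipoly_divide bipoly_add bipoly_diff P1 P2)+
  have t0: "t0 \<in> unipoly (Suc m)" and s0: "s0 \<in> unipoly (Suc m)"
    unfolding t0_def[abs_def] s0_def[abs_def] by (intro unipoly_divide T1 T2)+
  define Ry py where "Ry = dy (\<lambda>x y. y * (1 - y) * R0 x y)" and "py = dy (\<lambda>x y. y * (1 - y) * p x y)"
  define Rx px where "Rx = dx (\<lambda>x y. x * (1 - x) * R0 x y)" and "px = dx (\<lambda>x y. x * (1 - x) * p x y)"
  have "P1 x y = be * R0 x y + al * p x y" "P2 x y = al * p x y - be * R0 x y" for x y
    using al be by (simp_all add: p_def R0_def field_simps)
  note P12 = this
  have P: "(\<lambda>x y. y * (1 - y) * P1 x y) =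
      (\<lambda>x y. be * (y * (1 - y) * R0 x y) + al * (y * (1 - y) * p x y))"
    "(\<lambda>x y. x * (1 - x) * P2 x y) = (\<lambda>x y. al * (x * (1 - x) * p x y) - be * (x * (1 - x) * R0 x y))"
    by (simp_all only: P12) (simp_all add: algebra_simps)
  have A_eq: "prim k (\<lambda>h. A h x y) (Suc m) = be * Ry x y + al * py x y + al * (2 * t0 x)" for x y
  proof -
    have "dy (\<lambda>x y. y * (1 - y) * P1 x y) x y = be * Ry x y + al * py x y"
      unfolding P dy_add[OF bipoly_cmult[OF bipoly_ybubble[OF R0]] bipoly_cmult[OF bipoly_ybubble[OF p]]]
      unfolding dy_cmult[OF bipoly_ybubble[OF R0], of "\<lambda>_. be"] dy_cmult[OF bipoly_ybubble[OF p], of "\<lambda>_. al"]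
      by (simp add: Ry_def py_def)
    then show ?thesis
      unfolding A_eq using al by (simp add: t0_def)
  qed
  have B_eq: "prim k (\<lambda>h. B h x y) (Suc m) = al * px x y - be * Rx x y + al * (2 * s0 y)" for x y
  proof -
    have "dx (\<lambda>x y. x * (1 - x) * P2 x y) x y = al * px x y - be * Rx x y"
      unfolding P dx_diff[OF bipoly_cmult[OF bipoly_xbubble[OF p]] bipoly_cmult[OF bipoly_xbubble[OF R0]]]
      unfolding dx_cmult[OF bipoly_xbubble[OF R0], of "\<lambda>_. be"] dx_cmult[OF bipoly_xbubble[OF p], of "\<lambda>_. al"]
      by (simp add: Rx_def px_def)
    then show ?thesis
      unfolding B_eq using al by (simp add: s0_def)
  qed
  \<comment> \<open>Numerators of the prescribed z-derivatives. The choices above make their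
    obstructions vanish, see \<open>z1\<close> and \<open>z2\<close>.\<close>
  define n1 where "n1 h x y = B h x y + Rx x y * low h - (px x y + 2 * s0 y) * top h" for h x y
  define n2 where "n2 h x y = Ry x y * low h + (py x y + 2 * t0 x) * top h - A h x y" for h x y
  define f1 where "f1 h x y = prim k (\<lambda>h. n1 h x y) h" for h x y
  define f2 where "f2 h x y = prim k (\<lambda>h. n2 h x y) h" for h x y
  have Ry: "Ry \<in> bipoly (Suc m) (Suc (Suc m))" and py: "py \<in> bipoly (Suc m) (Suc (Suc m))"
    using bipoly_dy[OF bipoly_ybubble[OF R0]] bipoly_dy[OF bipoly_ybubble[OF p]]
    by (simp_all add: Ry_def py_def)
  have Rx: "Rx \<in> bipoly (Suc (Suc m)) (Suc m)" and px: "px \<in> bipoly (Suc (Suc m)) (Suc m)"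
    using bipoly_dx[OF bipoly_xbubble[OF R0]] bipoly_dx[OF bipoly_xbubble[OF p]]
    by (simp_all add: Rx_def px_def)
  have t0': "(\<lambda>x y. t0 x) \<in> bipoly (Suc m) (Suc (Suc m))"
    by (rule bipoly_unipoly[OF t0]) simp
  have s0': "(\<lambda>x y. s0 y) \<in> bipoly (Suc (Suc m)) (Suc m)"
    by (rule bipoly_swap[OF bipoly_unipoly[OF s0]]) simp
  have n1: "n1 h \<in> bipoly (Suc (Suc m)) (Suc m)" for h
  proof -
    have "(\<lambda>x y. B h x y + low h * Rx x y - top h * (px x y + 2 * s0 y)) \<in> bipoly (Suc (Suc m)) (Suc m)"
      by (intro bipoly_diff bipoly_add bipoly_cmult B Rx px s0')
    then show ?thesis by (simp add: n1_def[abs_def] mult.commute)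
  qed
  have n2: "n2 h \<in> bipoly (Suc m) (Suc (Suc m))" for h
  proof -
    have "(\<lambda>x y. low h * Ry x y + top h * (py x y + 2 * t0 x) - A h x y) \<in> bipoly (Suc m) (Suc (Suc m))"
      by (intro bipoly_diff bipoly_add bipoly_cmult A Ry py t0')
    then show ?thesis by (simp add: n2_def[abs_def] mult.commute)
  qed
  have f1: "f1 h \<in> bipoly (Suc (Suc m)) (Suc m)" and f2: "f2 h \<in> bipoly (Suc m) (Suc (Suc m))" for h
    unfolding f1_def[abs_def] f2_def[abs_def] by (intro prim_bipoly n1 n2)+
  have z1: "prim k (\<lambda>h. n1 h x y) (Suc m) = 0" for x y
    unfolding n1_def prim_diff prim_add prim_cmult B_eq al_def[symmetric] be_def[symmetric]
    by (simp add: algebra_simps)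
  have z2: "prim k (\<lambda>h. n2 h x y) (Suc m) = 0" for x y
    unfolding n2_def prim_diff prim_add prim_cmult A_eq al_def[symmetric] be_def[symmetric]
    by (simp add: algebra_simps)
  have low_sum: "(\<Sum>h<Suc (Suc m). c * low h * z ^ h) = c * (1 + z)" for c z
    unfolding mult.assoc sum_distrib_left[symmetric] low_def sum_first_two ..
  have top_sum: "(\<Sum>h<Suc (Suc m). c * top h * z ^ h) = c * z ^ Suc m" for c z
    unfolding mult.assoc sum_distrib_left[symmetric] top_def sum_last ..
  \<comment> \<open>The polynomial \<open>1 + z\<close> reaches the top power
    \<open>z ^ Suc m\<close> only for \<open>m = 0\<close>.\<close>
  have low_Suc: "low (Suc m) = of_bool (m = 0)" and top_Suc: "top (Suc m) = 1"
    by (auto simp: low_def top_def)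
  have "(\<Sum>h<Suc (Suc m). n1 h x y * z ^ h) = (\<Sum>h<Suc (Suc m). B h x y * z ^ h)
      + Rx x y * (1 + z) - (px x y + 2 * s0 y) * z ^ Suc m" for x y z
    unfolding low_sum[symmetric] top_sum[symmetric] sum.distrib[symmetric] sum_subtractf[symmetric]
    by (simp only: n1_def left_diff_distrib distrib_right)
  then have e1: "(\<Sum>h<Suc (Suc m). B h x y * z ^ h) =
      (\<Sum>h<Suc m. f1 h x y * ((real h + 1) * z ^ h + (real h - real k) * z ^ Suc h))
      - (1 + z) * Rx x y + z ^ Suc m * (px x y + 2 * s0 y)" for x y z
    using prim_exact(1)[OF z1 k, of x y z] by (simp only: f1_def mult.commute)
  have "(\<Sum>h<Suc (Suc m). n2 h x y * z ^ h) = Ry x y * (1 + z)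
      + (py x y + 2 * t0 x) * z ^ Suc m - (\<Sum>h<Suc (Suc m). A h x y * z ^ h)" for x y z
    unfolding low_sum[symmetric] top_sum[symmetric] sum.distrib[symmetric] sum_subtractf[symmetric]
    by (simp only: n2_def left_diff_distrib distrib_right)
  then have e2: "(\<Sum>h<Suc (Suc m). A h x y * z ^ h) = (1 + z) * Ry x y
      - (\<Sum>h<Suc m. f2 h x y * ((real h + 1) * z ^ h + (real h - real k) * z ^ Suc h))
      + z ^ Suc m * (py x y + 2 * t0 x)" for x y z
    using prim_exact(1)[OF z2 k, of x y z] by (simp only: f2_def mult.commute)
  have n1_top: "n1 (Suc m) x y = B (Suc m) x y + of_bool (m = 0) * Rx x y - (px x y + 2 * s0 y)" for x y
    by (simp only: n1_def low_Suc top_Suc mult.commute mult_1)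
  have n2_top: "n2 (Suc m) x y = of_bool (m = 0) * Ry x y + (py x y + 2 * t0 x) - A (Suc m) x y" for x y
    by (simp only: n2_def low_Suc top_Suc mult.commute mult_1)
  have m1: "2 * f1 m x y = - B (Suc m) x y - of_bool (m = 0) * Rx x y + px x y + 2 * s0 y" for x y
    using prim_exact(2)[OF z1 k, of x y] n1_top[of x y] unfolding f1_def by linarith
  have m2: "2 * f2 m x y = A (Suc m) x y - of_bool (m = 0) * Ry x y - py x y - 2 * t0 x" for x y
    using prim_exact(2)[OF z2 k, of x y] n2_top[of x y] unfolding f2_def by linarith
  show thesis
    by (rule that[OF f1 f2 R0 p t0 s0 e2[unfolded Ry_def py_def] e1[unfolded Rx_def px_def]
        m2[unfolded Ry_def py_def] m1[unfolded Rx_def px_def]])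
qed

section \<open>Pointwise curls and derivatives of rational fields\<close>

definition has_curl :: "(real^3 \<Rightarrow> real^3) \<Rightarrow> real^3 \<Rightarrow> real^3 \<Rightarrow> bool" where
  "has_curl W c q \<longleftrightarrow> (\<exists>a1 a2 a3 b1 b2 b3 c1 c2 c3.
    ((\<lambda>q. W q$1) has_derivative (\<lambda>d. a1 * d$1 + a2 * d$2 + a3 * d$3)) (at q) \<and>
    ((\<lambda>q. W q$2) has_derivative (\<lambda>d. b1 * d$1 + b2 * d$2 + b3 * d$3)) (at q) \<and>
    ((\<lambda>q. W q$3) has_derivative (\<lambda>d. c1 * d$1 + c2 * d$2 + c3 * d$3)) (at q) \<and>
    c = vector [c2 - b3, a3 - c1, b1 - a2])"

text \<open>\<open>push2_field\<close> is linear and at \<open>p\<close> sees only the value at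
  \<open>psi p\<close>, so a decomposition at single points can be transported, the value of the
  curl being inserted as a constant field.\<close>

lemma push2_field_cong_add:
  assumes "a (psi p) = b (psi p) + c (psi p)"
  shows "push2_field a p = push2_field b p + push2_field c p"
  by (simp add: push2_field_def Let_def assms vec_eq_iff forall_3 algebra_simps)

lemma curl_push1_field_has_curl:
  assumes "p \<in> pyramid - {apex}" "has_curl W c (psi p)"
  shows "curl_on pyramid (push1_field W) p = push2_field (\<lambda>_. c) p"
  using assms(2) curl_push1_field[OF assms(1)] unfolding has_curl_def by (elim exE conjE) simp

lemma has_derivative_bipoly_sum:
  fixes q :: "real^3"
  assumes F: "\<And>h. F h \<in> bipoly L M"
    and g: "\<And>h. (g h has_real_derivative g' h) (at (q$3))"
  shows "((\<lambda>q::real^3. \<Sum>h<n. F h (q$1) (q$2) * g h (q$3)) has_derivative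
    (\<lambda>d. (\<Sum>h<n. dx (F h) (q$1) (q$2) * g h (q$3)) * d$1 + (\<Sum>h<n. dy (F h) (q$1) (q$2) * g h (q$3)) * d$2
      + (\<Sum>h<n. F h (q$1) (q$2) * g' h) * d$3)) (at q)"
proof -
  have "((\<lambda>q::real^3. g h (q$3)) has_derivative (\<lambda>d. g' h * d$3)) (at q)" for h
    using has_derivative_compose[OF has_derivative_vec_nth g[unfolded has_field_derivative_def]]
    by (simp add: mult.commute)
  from has_derivative_sum[OF has_derivative_mult[OF has_derivative_bipoly[OF F] this]]
  show ?thesis
    by (rule has_derivative_eq_rhs)
      (simp add: fun_eq_iff sum.distrib sum_distrib_left sum_distrib_right algebra_simps)
qed

lemma DERIV_rational_power:
  assumes "1 + z \<noteq> (0::real)"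
  shows "((\<lambda>z. z ^ Suc h / (1 + z) ^ Suc k) has_real_derivative
    ((real h + 1) * z ^ h + (real h - real k) * z ^ Suc h) / (1 + z) ^ Suc (Suc k)) (at z)"
proof -
  have "((real h + 1) * z ^ h * (1 + z) ^ Suc k - z ^ Suc h * ((real k + 1) * (1 + z) ^ k)) / ((1 + z) ^ Suc k * (1 + z) ^ Suc k)
    = ((real h + 1) * z ^ h + (real h - real k) * z ^ Suc h) / (1 + z) ^ Suc (Suc k)"
    using assms by (simp add: frac_eq_eq) (simp add: algebra_simps)
  moreover have "((\<lambda>z. z ^ Suc h) has_real_derivative (real h + 1) * z ^ h) (at z)"
    "((\<lambda>z. (1 + z) ^ Suc k) has_real_derivative (real k + 1) * (1 + z) ^ k) (at z)"
    by (rule derivative_eq_intros refl | simp add: add.commute)+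
  ultimately show ?thesis
    using DERIV_divide[of "\<lambda>z. z ^ Suc h" _ z UNIV "\<lambda>z. (1 + z) ^ Suc k"] assms by fastforce
qed

lemma bipoly_0: "f \<in> bipoly 0 M \<Longrightarrow> f x y = 0" "f \<in> bipoly L 0 \<Longrightarrow> f x y = 0"
  by (auto simp: bipoly_def)

section \<open>Consequences of vanishing normal components\<close>

lemma bipoly_sum_vanish:
  assumes "\<And>z. z \<ge> 0 \<Longrightarrow> (\<Sum>h<n. c h * z ^ h) / (1 + z) ^ d = (0::real)" "h < n"
  shows "c h = 0"
proof (rule polyfun_zero_coeff[of "{0..}"])
  show "infinite {0::real..}"
    by (simp add: infinite_Ici)
  show "(\<Sum>h<n. c h * z ^ h) = 0" if "z \<in> {0..}" for z
    using assms(1)[of z] that by (auto simp: add_nonneg_eq_0_iff)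
qed (rule assms(2))

definition zero_flux :: "(real^3 \<Rightarrow> real^3) \<Rightarrow> bool" where
  "zero_flux u \<longleftrightarrow> (\<forall>q\<in>inf_pyramid. (q$1 \<in> {0, 1} \<longrightarrow> u q$1 = 0) \<and>
     (q$2 \<in> {0, 1} \<longrightarrow> u q$2 = 0) \<and> (q$3 = 0 \<longrightarrow> u q$3 = 0))"

text \<open>The conditions on a lateral face hold for all z >= 0, so every coefficient in
  \<open>z\<close> vanishes there separately, and \<open>bipoly_xfactor\<close> or
  \<open>bipoly_yfactor\<close> extracts the bubble.\<close>

lemma U2_inf_zero_flux_numerators:
  assumes "u \<in> U2_inf (Suc n)" and flux: "zero_flux u"
  obtains A B C where
    "\<And>h. A h \<in> bipoly n (Suc n)" "\<And>h. B h \<in> bipoly (Suc n) n" "\<And>h. C h \<in> bipoly (Suc n) (Suc n)"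
    "\<And>q. u q$1 = (\<Sum>h<Suc n. (q$1 * (1 - q$1) * A h (q$1) (q$2)) * q$3 ^ h) / (1 + q$3) ^ (Suc n + 2)"
    "\<And>q. u q$2 = (\<Sum>h<Suc n. (q$2 * (1 - q$2) * B h (q$1) (q$2)) * q$3 ^ h) / (1 + q$3) ^ (Suc n + 2)"
    "\<And>q. u q$3 = ((\<Sum>h<Suc n. C h (q$1) (q$2) * q$3 ^ h) +
      q$3 ^ n * (1 + q$3) * ((dx (\<lambda>x y. x * (1 - x) * A n x y) (q$1) (q$2) +
        dy (\<lambda>x y. y * (1 - y) * B n x y) (q$1) (q$2)) / 2)) / (1 + q$3) ^ (Suc n + 2)"
proof -
  obtain A B C where A: "\<And>h. A h \<in> bipoly (Suc (Suc n)) (Suc n)"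
    and B: "\<And>h. B h \<in> bipoly (Suc n) (Suc (Suc n))" and C: "\<And>h. C h \<in> bipoly (Suc n) (Suc n)"
    and u1: "\<And>q. u q$1 = (\<Sum>h<Suc n. A h (q$1) (q$2) * q$3 ^ h) / (1 + q$3) ^ (Suc n + 2)"
    and u2: "\<And>q. u q$2 = (\<Sum>h<Suc n. B h (q$1) (q$2) * q$3 ^ h) / (1 + q$3) ^ (Suc n + 2)"
    and u3: "\<And>q. u q$3 = ((\<Sum>h<Suc n. C h (q$1) (q$2) * q$3 ^ h) +
      q$3 ^ n * (1 + q$3) * ((dx (A n) (q$1) (q$2) + dy (B n) (q$1) (q$2)) / 2)) / (1 + q$3) ^ (Suc n + 2)"
    by (rule U2_inf_numerators[OF assms(1)]) blast
  have inf: "infinite {0..1::real}"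
    by (simp add: infinite_Icc)
  have "\<exists>g\<in>bipoly n (Suc n). \<forall>x y. A h x y = x * (1 - x) * g x y" if "h < Suc n" for h
  proof -
    have A0: "A h x y = 0" if "x \<in> {0, 1}" "y \<in> {0..1}" for x y
    proof (rule bipoly_sum_vanish[OF _ \<open>h < Suc n\<close>])
      fix z :: real assume "z \<ge> 0"
      then have "u (vector [x, y, z])$1 = 0"
        using flux that by (auto simp: zero_flux_def inf_pyramid_def)
      then show "(\<Sum>h<Suc n. A h x y * z ^ h) / (1 + z) ^ (Suc n + 2) = 0"
        unfolding u1 by (simp only: vector_3)
    qed
    show ?thesis
      using bipoly_xfactor[OF A inf, of h] A0 by (auto simp: numeral_2_eq_2)
  qed
  then have "\<forall>h. \<exists>g. h < Suc n \<longrightarrow> g \<in> bipoly n (Suc n) \<and> A h = (\<lambda>x y. x * (1 - x) * g x y)"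
    unfolding fun_eq_iff by blast
  then obtain A' where A': "\<And>h. h < Suc n \<Longrightarrow> A' h \<in> bipoly n (Suc n)"
    "\<And>h. h < Suc n \<Longrightarrow> A h = (\<lambda>x y. x * (1 - x) * A' h x y)"
    using choice[of "\<lambda>h g. h < Suc n \<longrightarrow> g \<in> bipoly n (Suc n) \<and> A h = (\<lambda>x y. x * (1 - x) * g x y)"] by blast
  have "\<exists>g\<in>bipoly (Suc n) n. \<forall>x y. B h x y = y * (1 - y) * g x y" if "h < Suc n" for h
  proof -
    have B0: "B h x y = 0" if "x \<in> {0..1}" "y \<in> {0, 1}" for x y
    proof (rule bipoly_sum_vanish[OF _ \<open>h < Suc n\<close>])
      fix z :: real assume "z \<ge> 0"
      then have "u (vector [x, y, z])$2 = 0"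
        using flux that by (auto simp: zero_flux_def inf_pyramid_def)
      then show "(\<Sum>h<Suc n. B h x y * z ^ h) / (1 + z) ^ (Suc n + 2) = 0"
        unfolding u2 by (simp only: vector_3)
    qed
    show ?thesis
      using bipoly_yfactor[OF B inf, of h] B0 by (auto simp: numeral_2_eq_2)
  qed
  then have "\<forall>h. \<exists>g. h < Suc n \<longrightarrow> g \<in> bipoly (Suc n) n \<and> B h = (\<lambda>x y. y * (1 - y) * g x y)"
    unfolding fun_eq_iff by blast
  then obtain B' where B': "\<And>h. h < Suc n \<Longrightarrow> B' h \<in> bipoly (Suc n) n"
    "\<And>h. h < Suc n \<Longrightarrow> B h = (\<lambda>x y. y * (1 - y) * B' h x y)"
    using choice[of "\<lambda>h g. h < Suc n \<longrightarrow> g \<in> bipoly (Suc n) n \<and> B h = (\<lambda>x y. y * (1 - y) * g x y)"] by blast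
  \<comment> \<open>The factors exist only for \<open>h < Suc n\<close>; filling up with zero gives
    membership for every index.\<close>
  define A'' where "A'' h = (if h < Suc n then A' h else (\<lambda>x y. 0))" for h
  define B'' where "B'' h = (if h < Suc n then B' h else (\<lambda>x y. 0))" for h
  have A'': "A h x y = x * (1 - x) * A'' h x y" and B'': "B h x y = y * (1 - y) * B'' h x y"
    if "h < Suc n" for h x y
    using A'(2)[OF that] B'(2)[OF that] that by (simp_all add: A''_def B''_def)
  show thesis
  proof (rule that[of A'' B'' C])
    show "A'' h \<in> bipoly n (Suc n)" "B'' h \<in> bipoly (Suc n) n" for h
      using A'(1) B'(1) by (simp_all add: A''_def B''_def bipoly_zero)
    show "u q$1 = (\<Sum>h<Suc n. (q$1 * (1 - q$1) * A'' h (q$1) (q$2)) * q$3 ^ h) / (1 + q$3) ^ (Suc n + 2)"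
      "u q$2 = (\<Sum>h<Suc n. (q$2 * (1 - q$2) * B'' h (q$1) (q$2)) * q$3 ^ h) / (1 + q$3) ^ (Suc n + 2)" for q
      unfolding u1 u2 using A'' B'' by (auto intro!: arg_cong2[of _ _ _ _ "(/)"] sum.cong)
    have "A n = (\<lambda>x y. x * (1 - x) * A'' n x y)" "B n = (\<lambda>x y. y * (1 - y) * B'' n x y)"
      using A'' B'' by (simp_all add: fun_eq_iff)
    then show "u q$3 = ((\<Sum>h<Suc n. C h (q$1) (q$2) * q$3 ^ h) +
      q$3 ^ n * (1 + q$3) * ((dx (\<lambda>x y. x * (1 - x) * A'' n x y) (q$1) (q$2) +
        dy (\<lambda>x y. y * (1 - y) * B'' n x y) (q$1) (q$2)) / 2)) / (1 + q$3) ^ (Suc n + 2)" for q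
      unfolding u3 by simp
  qed (rule C)
qed

text \<open>By \<open>pullback2_phi\<close> the first component is a multiple of
  \<open>e$1 + q$1 * e$3\<close>: at \<open>q$1 = 0\<close> and \<open>q$1 = 1\<close> this is, up
  to sign, the product of \<open>v\<close> with the face normal. The other faces are alike.\<close>

lemma pullback2_zero_flux:
  assumes "v \<in> U2_0 k"
  shows "zero_flux (pullback2 phi v)"
  unfolding zero_flux_def
proof (intro ballI conjI impI)
  fix q assume q: "q \<in> inf_pyramid"
  then have l: "1 + q$3 > 0"
    by (simp add: inf_pyramid_def)
  have F: "v (phi q) \<bullet> n = 0" if "(F, n) \<in> pyramid_faces" "phi q \<in> F" for F n
    using assms that phi_in_pyramid[OF q] by (auto simp: U2_0_def)
  have pq: "phi q \<in> pyramid"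
    using phi_in_pyramid[OF q] by simp
  show "pullback2 phi v q$1 = 0" if "q$1 \<in> {0, 1}"
  proof (cases "q$1 = 0")
    case True
    then have "v (phi q) \<bullet> vector [-1, 0, 0] = 0"
      by (intro F[of "{p \<in> pyramid. p$1 = 0}"]) (use pq in \<open>auto simp: pyramid_faces_def phi_def\<close>)
    then show ?thesis
      using l True by (simp add: pullback2_phi Let_def inner_vec_def sum_3)
  next
    case False
    then have "v (phi q) \<bullet> vector [1, 0, 1] = 0"
      using that l pq by (intro F[of "{p \<in> pyramid. p$1 = 1 - p$3}"])
        (auto simp: pyramid_faces_def, simp add: phi_def field_simps)
    then show ?thesis
      using l False that by (simp add: pullback2_phi Let_def inner_vec_def sum_3)
  qed
  show "pullback2 phi v q$2 = 0" if "q$2 \<in> {0, 1}"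
  proof (cases "q$2 = 0")
    case True
    then have "v (phi q) \<bullet> vector [0, -1, 0] = 0"
      by (intro F[of "{p \<in> pyramid. p$2 = 0}"]) (use pq in \<open>auto simp: pyramid_faces_def phi_def\<close>)
    then show ?thesis
      using l True by (simp add: pullback2_phi Let_def inner_vec_def sum_3)
  next
    case False
    then have "v (phi q) \<bullet> vector [0, 1, 1] = 0"
      using that l pq by (intro F[of "{p \<in> pyramid. p$2 = 1 - p$3}"])
        (auto simp: pyramid_faces_def, simp add: phi_def field_simps)
    then show ?thesis
      using l False that by (simp add: pullback2_phi Let_def inner_vec_def sum_3)
  qed
  show "pullback2 phi v q$3 = 0" if "q$3 = 0"
  proof -
    have "v (phi q) \<bullet> vector [0, 0, -1] = 0"
      by (intro F[of "{p \<in> pyramid. p$3 = 0}"]) (use pq that in \<open>auto simp: pyramid_faces_def phi_def\<close>)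
    then show ?thesis
      using l by (simp add: pullback2_phi Let_def inner_vec_def sum_3)
  qed
qed

section \<open>All three components on the infinite pyramid\<close>

lemma rat_QI:
  assumes "\<And>h. F h \<in> bipoly (nat (l + 1)) (nat (m + 1))"
    "\<And>x y z. f x y z = (\<Sum>h<nat (n + 1). F h x y * z ^ h) / (1 + z) ^ d"
  shows "f \<in> rat_Q d l m n"
  unfolding rat_Q_iff using assms by (intro exI[of _ F] conjI allI ext) auto

lemma field3_nth:
  "field3 f g h p$1 = f (p$1) (p$2) (p$3)" "field3 f g h p$2 = g (p$1) (p$2) (p$3)"
  "field3 f g h p$3 = h (p$1) (p$2) (p$3)"
  by (simp_all add: field3_def)

lemma inf_decomposition_zero:
  assumes "\<And>q. q \<in> inf_pyramid \<Longrightarrow> u q = 0"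
  shows "\<exists>W\<in>U1_inf_curl k. \<exists>w\<in>U2_inf_div k. \<forall>q\<in>inf_pyramid. \<exists>c. has_curl W c q \<and> u q = c + w q"
proof -
  let ?z = "\<lambda>x y z::real. 0::real"
  let ?o = "\<lambda>x y::real. 0::real"
  have zero: "?z \<in> rat_Q d l m n" for d l m n
    by (rule rat_QI[of "\<lambda>h x y. 0"]) (auto intro: bipoly_zero)
  have d0: "dx ?o = ?o" "dy ?o = ?o"
    by (simp_all add: dx_def dy_def fun_eq_iff)
  have "field3 ?z ?z ?z \<in> U1_inf_curl k"
    unfolding U1_inf_curl_def mem_Collect_eq
    by (rule exI[of _ ?z], rule exI[of _ ?z], rule exI[of _ ?z]) (simp add: zero)
  moreover have "field3 ?z ?z ?z \<in> U2_inf_div k"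
    unfolding U2_inf_div_def mem_Collect_eq
    by (rule exI[of _ ?o], rule exI[of _ ?o], rule exI[of _ ?o], rule exI[of _ ?z])
      (auto simp: zero d0 poly_Q2_bipoly poly_P1_unipoly intro!: bexI[of _ ?o] bexI[of _ "\<lambda>_. 0"]
        bipoly_zero unipoly_zero)
  moreover have "has_curl (field3 ?z ?z ?z) 0 q" for q
    unfolding has_curl_def field3_nth
    by (intro exI[of _ 0] conjI) (auto simp: vec_eq_iff forall_3)
  moreover have "field3 ?z ?z ?z q = 0" for q
    by (simp add: field3_def vec_eq_iff forall_3)
  ultimately show ?thesis
    using assms by (metis add.right_neutral)
qed

lemma inf_decomposition:
  assumes "u \<in> U2_inf (Suc n)" "zero_flux u"
  shows "\<exists>W\<in>U1_inf_curl (Suc n). \<exists>w\<in>U2_inf_div (Suc n).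
    \<forall>q\<in>inf_pyramid. \<exists>c. has_curl W c q \<and> u q = c + w q"
proof -
  obtain A B C where A: "\<And>h. A h \<in> bipoly n (Suc n)" and B: "\<And>h. B h \<in> bipoly (Suc n) n"
    and C: "\<And>h. C h \<in> bipoly (Suc n) (Suc n)"
    and u1: "\<And>q. u q$1 = (\<Sum>h<Suc n. (q$1 * (1 - q$1) * A h (q$1) (q$2)) * q$3 ^ h) / (1 + q$3) ^ (Suc n + 2)"
    and u2: "\<And>q. u q$2 = (\<Sum>h<Suc n. (q$2 * (1 - q$2) * B h (q$1) (q$2)) * q$3 ^ h) / (1 + q$3) ^ (Suc n + 2)"
    and u3: "\<And>q. u q$3 = ((\<Sum>h<Suc n. C h (q$1) (q$2) * q$3 ^ h) +
      q$3 ^ n * (1 + q$3) * ((dx (\<lambda>x y. x * (1 - x) * A n x y) (q$1) (q$2) +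
        dy (\<lambda>x y. y * (1 - y) * B n x y) (q$1) (q$2)) / 2)) / (1 + q$3) ^ (Suc n + 2)"
    by (rule U2_inf_zero_flux_numerators[OF assms]) blast
  have base: "u (vector [x, y, 0])$3 = 0" if "0 \<le> x" "x \<le> 1" "0 \<le> y" "y \<le> 1" for x y
    using assms(2) that by (auto simp: zero_flux_def inf_pyramid_def)
  show ?thesis
  proof (cases n)
    case 0
    \<comment> \<open>Here \<open>k = 1\<close>: the coefficients of the first two components lie in
      zero spaces, and the base condition kills the remaining \<open>C 0\<close>, so
      \<open>u\<close> vanishes.\<close>
    have AB0: "A 0 x y = 0" "B 0 x y = 0" for x y
      using bipoly_0 A[of 0] B[of 0] unfolding 0 by blast+
    have d0: "dx (\<lambda>x y. 0) x y = 0" "dy (\<lambda>x y. 0) x y = 0" for x y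
      by (auto simp: dx_def dy_def)
    have "C 0 x y = 0" if "0 \<le> x" "x \<le> 1" "0 \<le> y" "y \<le> 1" for x y
      using base[OF that] unfolding u3 0 by (simp add: AB0 d0)
    then have "u q = 0" if "q \<in> inf_pyramid" for q
      using that unfolding vec_eq_iff forall_3 u1 u2 u3 0
      by (simp add: AB0 d0 inf_pyramid_def)
    then show ?thesis
      by (rule inf_decomposition_zero)
  next
    case (Suc m)
    define k where "k = Suc (Suc m)"
    obtain f1 f2 R0 p t0 s0 where
      f1: "\<And>h. f1 h \<in> bipoly (Suc (Suc m)) (Suc m)" and f2: "\<And>h. f2 h \<in> bipoly (Suc m) (Suc (Suc m))" and
      R0: "R0 \<in> bipoly (Suc m) (Suc m)" and p: "p \<in> bipoly (Suc m) (Suc m)" and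
      t0: "t0 \<in> unipoly (Suc m)" and s0: "s0 \<in> unipoly (Suc m)" and
      A_eq: "\<And>x y z. (\<Sum>h<Suc (Suc m). A h x y * z ^ h) = (1 + z) * dy (\<lambda>x y. y * (1 - y) * R0 x y) x y
        - (\<Sum>h<Suc m. f2 h x y * ((real h + 1) * z ^ h + (real h - real k) * z ^ Suc h))
        + z ^ Suc m * (dy (\<lambda>x y. y * (1 - y) * p x y) x y + 2 * t0 x)" and
      B_eq: "\<And>x y z. (\<Sum>h<Suc (Suc m). B h x y * z ^ h) =
        (\<Sum>h<Suc m. f1 h x y * ((real h + 1) * z ^ h + (real h - real k) * z ^ Suc h))
        - (1 + z) * dx (\<lambda>x y. x * (1 - x) * R0 x y) x y
        + z ^ Suc m * (dx (\<lambda>x y. x * (1 - x) * p x y) x y + 2 * s0 y)" and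
      f2_top: "\<And>x y. 2 * f2 m x y = A (Suc m) x y - of_bool (m = 0) * dy (\<lambda>x y. y * (1 - y) * R0 x y) x y
        - dy (\<lambda>x y. y * (1 - y) * p x y) x y - 2 * t0 x" and
      f1_top: "\<And>x y. 2 * f1 m x y = - B (Suc m) x y - of_bool (m = 0) * dx (\<lambda>x y. x * (1 - x) * R0 x y) x y
        + dx (\<lambda>x y. x * (1 - x) * p x y) x y + 2 * s0 y"
      by (rule horizontal_decomposition[of A m B k, OF A[unfolded Suc] B[unfolded Suc] k_def]) blast
    \<comment> \<open>With the bubbles restored, \<open>F\<close>, \<open>G\<close> and
      \<open>R\<close> are the numerator coefficients of the first, second and third component of
      \<open>W\<close>.\<close>
    define G where "G h x y = x * (1 - x) * f2 h x y" for h x y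
    define F where "F h x y = y * (1 - y) * f1 h x y" for h x y
    define R where "R x y = x * (1 - x) * (y * (1 - y) * R0 x y)" for x y
    define r where "r x y = x * (1 - x) * (y * (1 - y) * p x y)" for x y
    define t where "t x (y::real) = x * (1 - x) * t0 x" for x y
    define s where "s (x::real) y = y * (1 - y) * s0 y" for x y
    define A2 where "A2 x y = x * (1 - x) * A (Suc m) x y" for x y
    define B2 where "B2 x y = y * (1 - y) * B (Suc m) x y" for x y
    have G: "G h \<in> bipoly (Suc (Suc (Suc m))) (Suc (Suc m))" for h
      using bipoly_xbubble[OF f2[of h]] by (simp add: G_def[abs_def])
    have F: "F h \<in> bipoly (Suc (Suc m)) (Suc (Suc (Suc m)))" for h
      using bipoly_ybubble[OF f1[of h]] by (simp add: F_def[abs_def])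
    let ?N = "Suc (Suc (Suc m))"
    have R: "R \<in> bipoly ?N ?N"
      using bipoly_xbubble[OF bipoly_ybubble[OF R0]] by (simp add: R_def[abs_def])
    have r: "r \<in> bipoly ?N ?N"
      using bipoly_xbubble[OF bipoly_ybubble[OF p]] by (simp add: r_def[abs_def])
    have t: "t \<in> bipoly ?N 1"
      using bipoly_xbubble[OF bipoly_unipoly[OF t0, of 1]] by (simp add: t_def[abs_def])
    have s: "s \<in> bipoly 1 ?N"
      using bipoly_ybubble[OF bipoly_swap[OF bipoly_unipoly[OF s0, of 1]]] by (simp add: s_def[abs_def])
    have A2: "A2 \<in> bipoly ?N (Suc (Suc m))"
      using bipoly_xbubble[OF A[of "Suc m"]] by (simp add: A2_def[abs_def] Suc)
    have B2: "B2 \<in> bipoly (Suc (Suc m)) ?N"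
      using bipoly_ybubble[OF B[of "Suc m"]] by (simp add: B2_def[abs_def] Suc)
    have R_alt: "R = (\<lambda>x y. y * (1 - y) * (x * (1 - x) * R0 x y))"
      and r_alt: "r = (\<lambda>x y. y * (1 - y) * (x * (1 - x) * p x y))"
      by (simp_all add: R_def[abs_def] r_def[abs_def] fun_eq_iff)
    have dyR: "dy R x y = x * (1 - x) * dy (\<lambda>x y. y * (1 - y) * R0 x y) x y"
      and dyr: "dy r x y = x * (1 - x) * dy (\<lambda>x y. y * (1 - y) * p x y) x y" for x y
      unfolding R_def[abs_def] r_def[abs_def]
      by (rule dy_cmult[OF bipoly_ybubble[OF R0]] dy_cmult[OF bipoly_ybubble[OF p]])+
    have dxR: "dx R x y = y * (1 - y) * dx (\<lambda>x y. x * (1 - x) * R0 x y) x y"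
      and dxr: "dx r x y = y * (1 - y) * dx (\<lambda>x y. x * (1 - x) * p x y) x y" for x y
      unfolding R_alt r_alt
      by (rule dx_cmult[OF bipoly_xbubble[OF R0]] dx_cmult[OF bipoly_xbubble[OF p]])+
    have numerator1: "(\<Sum>h<Suc n. (x * (1 - x) * A h x y) * z ^ h) = (1 + z) * dy R x y
        - (\<Sum>h<Suc m. G h x y * ((real h + 1) * z ^ h + (real h - real k) * z ^ Suc h))
        + z ^ Suc m * (dy r x y + 2 * t x y)" for x y z
    proof -
      have "(\<Sum>h<Suc n. (x * (1 - x) * A h x y) * z ^ h) = x * (1 - x) * (\<Sum>h<Suc (Suc m). A h x y * z ^ h)"
        by (simp only: Suc sum_distrib_left mult.assoc)
      moreover have "(\<Sum>h<Suc m. G h x y * ((real h + 1) * z ^ h + (real h - real k) * z ^ Suc h)) =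
          x * (1 - x) * (\<Sum>h<Suc m. f2 h x y * ((real h + 1) * z ^ h + (real h - real k) * z ^ Suc h))"
        by (simp only: G_def sum_distrib_left mult.assoc)
      ultimately show ?thesis
        unfolding A_eq dyR dyr t_def by (simp only: algebra_simps)
    qed
    have numerator2: "(\<Sum>h<Suc n. (y * (1 - y) * B h x y) * z ^ h) =
        (\<Sum>h<Suc m. F h x y * ((real h + 1) * z ^ h + (real h - real k) * z ^ Suc h))
        - (1 + z) * dx R x y + z ^ Suc m * (dx r x y + 2 * s x y)" for x y z
    proof -
      have "(\<Sum>h<Suc n. (y * (1 - y) * B h x y) * z ^ h) = y * (1 - y) * (\<Sum>h<Suc (Suc m). B h x y * z ^ h)"
        by (simp only: Suc sum_distrib_left mult.assoc)
      moreover have "(\<Sum>h<Suc m. F h x y * ((real h + 1) * z ^ h + (real h - real k) * z ^ Suc h)) =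
          y * (1 - y) * (\<Sum>h<Suc m. f1 h x y * ((real h + 1) * z ^ h + (real h - real k) * z ^ Suc h))"
        by (simp only: F_def sum_distrib_left mult.assoc)
      ultimately show ?thesis
        unfolding B_eq dxR dxr s_def by (simp only: algebra_simps)
    qed
    \<comment> \<open>The coefficients of the third curl component, apart from powers of
      \<open>z\<close> and the denominator.\<close>
    define K where "K h x y = dx (G h) x y - dy (F h) x y" for h x y
    have K: "K h \<in> bipoly (Suc (Suc m)) (Suc (Suc m))" for h
      using bipoly_diff[of "dx (G h)" "Suc (Suc m)" "Suc (Suc m)" "dy (F h)"]
        bipoly_dx[OF G[of h]] bipoly_dy[OF F[of h]]
      by (simp add: K_def[abs_def])
    \<comment> \<open>In the difference of the two derivatives the terms in \<open>R\<close> cancel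
      by symmetry of mixed derivatives, while those in \<open>r\<close> add up.\<close>
    have K_top: "2 * K m x y = dx A2 x y + dy B2 x y - 2 * (dy (dx r) x y + dy s x y + dx t x y)" for x y
    proof -
      let ?c = "of_bool (m = 0) :: real"
      \<comment> \<open>A common space is needed because \<open>bipoly_add\<close> and
        \<open>bipoly_diff\<close> combine only members of the same space.\<close>
      have N: "A2 \<in> bipoly ?N ?N" "B2 \<in> bipoly ?N ?N" "t \<in> bipoly ?N ?N" "s \<in> bipoly ?N ?N"
        "dx R \<in> bipoly ?N ?N" "dy R \<in> bipoly ?N ?N" "dx r \<in> bipoly ?N ?N" "dy r \<in> bipoly ?N ?N"
        by (rule bipoly_mono[OF A2] bipoly_mono[OF B2] bipoly_mono[OF t] bipoly_mono[OF s]
            bipoly_mono[OF bipoly_dx[OF R]] bipoly_mono[OF bipoly_dy[OF R]]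
            bipoly_mono[OF bipoly_dx[OF r]] bipoly_mono[OF bipoly_dy[OF r]]; simp)+
      have "2 * G m x y = A2 x y - ?c * dy R x y - dy r x y - 2 * t x y" for x y
      proof -
        have "2 * G m x y = x * (1 - x) * (2 * f2 m x y)"
          by (simp add: G_def)
        then show ?thesis
          unfolding f2_top A2_def dyR dyr t_def by (simp only: algebra_simps)
      qed
      then have "dx (\<lambda>x y. 2 * G m x y) x y = dx (\<lambda>x y. A2 x y - ?c * dy R x y - dy r x y - 2 * t x y) x y"
        by simp
      then have "2 * dx (G m) x y = dx A2 x y - ?c * dx (dy R) x y - dx (dy r) x y - 2 * dx t x y"
        by (simp only: dx_diff[OF bipoly_diff[OF bipoly_diff[OF N(1) bipoly_cmult[OF N(6)]] N(8)] bipoly_cmult[OF N(3)]]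
            dx_diff[OF bipoly_diff[OF N(1) bipoly_cmult[OF N(6)]] N(8)]
            dx_diff[OF N(1) bipoly_cmult[OF N(6)]]
            dx_cmult[OF N(6), of "\<lambda>_. ?c"] dx_cmult[OF N(3), of "\<lambda>_. 2"] dx_cmult[OF G, of "\<lambda>_. 2"])
      moreover have "2 * F m x y = dx r x y + 2 * s x y - B2 x y - ?c * dx R x y" for x y
      proof -
        have "2 * F m x y = y * (1 - y) * (2 * f1 m x y)"
          by (simp add: F_def)
        then show ?thesis
          unfolding f1_top B2_def dxR dxr s_def by (simp only: algebra_simps)
      qed
      then have "dy (\<lambda>x y. 2 * F m x y) x y = dy (\<lambda>x y. dx r x y + 2 * s x y - B2 x y - ?c * dx R x y) x y"
        by simp
      then have "2 * dy (F m) x y = dy (dx r) x y + 2 * dy s x y - dy B2 x y - ?c * dy (dx R) x y"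
        by (simp only: dy_diff[OF bipoly_diff[OF bipoly_add[OF N(7) bipoly_cmult[OF N(4)]] N(2)] bipoly_cmult[OF N(5)]]
            dy_diff[OF bipoly_add[OF N(7) bipoly_cmult[OF N(4)]] N(2)]
            dy_add[OF N(7) bipoly_cmult[OF N(4)]]
            dy_cmult[OF N(5), of "\<lambda>_. ?c"] dy_cmult[OF N(4), of "\<lambda>_. 2"] dy_cmult[OF F, of "\<lambda>_. 2"])
      ultimately show ?thesis
        unfolding K_def dx_dy[OF R] dx_dy[OF r] by (simp add: right_diff_distrib)
    qed
    \<comment> \<open>After division by \<open>z\<close>, what remains for \<open>\<chi>3\<close> is
      the sum of the \<open>C (Suc h)\<close> minus \<open>1 + z\<close> times the sum of the
      \<open>K h\<close>. By \<open>K_top\<close> the term \<open>K m\<close> cancels against the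
      special part of \<open>u\<close>, leaving degree at most \<open>m = k - 2\<close> in
      \<open>z\<close>.\<close>
    define X where "X h x y = C (Suc h) x y - (if h < m then K h x y else 0) - (if h = 0 then 0 else K (h - 1) x y)" for h x y
    have X: "X h \<in> bipoly (Suc (Suc m)) (Suc (Suc m))" for h
      unfolding X_def[abs_def]
      by (intro bipoly_diff; cases "h < m"; cases "h = 0") (use C K in \<open>simp_all add: Suc bipoly_zero\<close>)
    have X_sum: "(\<Sum>h<Suc m. X h x y * z ^ h) =
        (\<Sum>h<Suc m. C (Suc h) x y * z ^ h) - (1 + z) * (\<Sum>h<m. K h x y * z ^ h)" for x y z
    proof -
      have "(\<Sum>h<Suc m. (if h = 0 then 0 else K (h - 1) x y) * z ^ h) = (\<Sum>h<m. K h x y * z ^ Suc h)"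
        by (subst sum.lessThan_Suc_shift) simp
      moreover have "(\<Sum>h<Suc m. (if h < m then K h x y else 0) * z ^ h) = (\<Sum>h<m. K h x y * z ^ h)"
        by simp
      moreover have "(\<Sum>h<m. K h x y * z ^ Suc h) = z * (\<Sum>h<m. K h x y * z ^ h)"
        by (simp add: sum_distrib_left mult.left_commute)
      ultimately show ?thesis
        by (simp only: X_def left_diff_distrib sum_subtractf) (simp add: algebra_simps)
    qed
    define W where "W = field3
      (\<lambda>x y z. y * (1 - y) * z * ((\<Sum>h<Suc m. f1 h x y * z ^ h) / (1 + z) ^ (k + 1)))
      (\<lambda>x y z. x * (1 - x) * z * ((\<Sum>h<Suc m. f2 h x y * z ^ h) / (1 + z) ^ (k + 1)))
      (\<lambda>x y z. x * (1 - x) * y * (1 - y) * (R0 x y / (1 + z) ^ (k + 1)))"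
    define w where "w = field3
      (\<lambda>x y z. z ^ (k - 1) / (1 + z) ^ (k + 2) * (dy r x y + 2 * t x y))
      (\<lambda>x y z. z ^ (k - 1) / (1 + z) ^ (k + 2) * (dx r x y + 2 * s x y))
      (\<lambda>x y z. z ^ (k - 1) / (1 + z) ^ (k + 2) * ((1 + z) * (dy (dx r) x y + dy s x y + dx t x y))
               + z * ((\<Sum>h<Suc m. X h x y * z ^ h) / (1 + z) ^ (k + 2)))"
    have nats: "nat (int k - 1 + 1) = Suc (Suc m)" "nat (int k - 2 + 1) = Suc m" "nat (0 + 1) = 1"
      by (auto simp: k_def)
    have W: "W \<in> U1_inf_curl k"
      unfolding U1_inf_curl_def mem_Collect_eq W_def
      by (intro exI conjI, rule refl; rule rat_QI, unfold nats) (rule f1 f2 R0 refl | simp)+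
    have w: "w \<in> U2_inf_div k"
      unfolding U2_inf_div_def mem_Collect_eq w_def
    proof (intro exI conjI, rule refl)
      show "\<exists>p\<in>poly_Q2 (int k - 2) (int k - 2). r = (\<lambda>x y. x * (1 - x) * y * (1 - y) * p x y)"
        unfolding poly_Q2_bipoly nats by (rule bexI[OF _ p]) (simp add: r_def fun_eq_iff)
      show "\<exists>t'\<in>poly_P1 (int k - 2). t = (\<lambda>x y. x * (1 - x) * t' x)"
        unfolding poly_P1_unipoly nats by (rule bexI[OF _ t0]) (simp add: t_def fun_eq_iff)
      show "\<exists>s'\<in>poly_P1 (int k - 2). s = (\<lambda>x y. y * (1 - y) * s' y)"
        unfolding poly_P1_unipoly nats by (rule bexI[OF _ s0]) (simp add: s_def fun_eq_iff)
      show "(\<lambda>x y z. (\<Sum>h<Suc m. X h x y * z ^ h) / (1 + z) ^ (k + 2))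
          \<in> rat_Q (k + 2) (int k - 1) (int k - 1) (int k - 2)"
        by (rule rat_QI, unfold nats) (rule X refl)+
    qed
    have W1: "W q$1 = (\<Sum>h<Suc m. F h (q$1) (q$2) * (q$3 ^ Suc h / (1 + q$3) ^ (k + 1)))"
      and W2: "W q$2 = (\<Sum>h<Suc m. G h (q$1) (q$2) * (q$3 ^ Suc h / (1 + q$3) ^ (k + 1)))"
      and W3: "W q$3 = R (q$1) (q$2) * (1 / (1 + q$3) ^ (k + 1))" for q
      unfolding W_def field3_nth F_def G_def R_def sum_divide_distrib sum_distrib_left
      by (auto intro!: sum.cong simp: mult_ac simp del: sum.lessThan_Suc)
    have "\<exists>c. has_curl W c q \<and> u q = c + w q" if q: "q \<in> inf_pyramid" for q
    proof -
      define x y z where "x = q$1" and "y = q$2" and "z = q$3"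
      have z: "1 + z \<noteq> 0"
        using q by (simp add: inf_pyramid_def z_def)
      define D where "D h = ((real h + 1) * z ^ h + (real h - real k) * z ^ Suc h) / (1 + z) ^ (k + 2)" for h
      have D: "((\<lambda>z. z ^ Suc h / (1 + z) ^ (k + 1)) has_real_derivative D h) (at (q$3))" for h
        using DERIV_rational_power[OF z, of h k] by (simp add: D_def z_def)
      \<comment> \<open>The value \<open>E\<close> can stay unspecified: the z-derivative of the
        third component does not enter the curl.\<close>
      have "(\<lambda>z. 1 / (1 + z) ^ (k + 1)) field_differentiable at (q$3)"
        by (intro derivative_intros) (use z in \<open>simp add: z_def\<close>)
      then obtain E where E: "((\<lambda>z. 1 / (1 + z) ^ (k + 1)) has_real_derivative E) (at (q$3))"
        unfolding field_differentiable_def by blast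
      let ?g = "\<lambda>h::nat. z ^ Suc h / (1 + z) ^ (k + 1)"
      have d1: "((\<lambda>q. W q$1) has_derivative (\<lambda>d. (\<Sum>h<Suc m. dx (F h) x y * ?g h) * d$1 +
          (\<Sum>h<Suc m. dy (F h) x y * ?g h) * d$2 + (\<Sum>h<Suc m. F h x y * D h) * d$3)) (at q)"
        using has_derivative_bipoly_sum[OF F D, where n = "Suc m"] unfolding W1 x_def y_def z_def .
      have d2: "((\<lambda>q. W q$2) has_derivative (\<lambda>d. (\<Sum>h<Suc m. dx (G h) x y * ?g h) * d$1 +
          (\<Sum>h<Suc m. dy (G h) x y * ?g h) * d$2 + (\<Sum>h<Suc m. G h x y * D h) * d$3)) (at q)"
        using has_derivative_bipoly_sum[OF G D, where n = "Suc m"] unfolding W2 x_def y_def z_def .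
      have d3: "((\<lambda>q. W q$3) has_derivative (\<lambda>d. dx R x y / (1 + z) ^ (k + 1) * d$1 +
          dy R x y / (1 + z) ^ (k + 1) * d$2 + R x y * E * d$3)) (at q)"
        using has_derivative_bipoly_sum[OF R E, where n = "Suc 0"] unfolding W3 x_def y_def z_def by simp
      \<comment> \<open>At \<open>z = 0\<close> only the constant coefficient survives, so the base
        condition makes the numerator divisible by \<open>z\<close>.\<close>
      have C0: "C 0 x y = 0"
        using base[of x y] q unfolding u3 Suc
        by (simp add: inf_pyramid_def x_def y_def sum.lessThan_Suc_shift del: sum.lessThan_Suc)
      define P where "P = (1 + z) ^ (k + 2)"
      have Pk: "c / (1 + z) ^ (k + 1) = (1 + z) * c / P" for c
        using z by (simp add: P_def)
      have nk: "Suc n + 2 = k + 2" "k - 1 = Suc m"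
        by (simp_all add: k_def Suc)
      note unfold_q = x_def[symmetric] y_def[symmetric] z_def[symmetric] nk P_def[symmetric]
      have sum_D: "(\<Sum>h<Suc m. H h * D h) =
          (\<Sum>h<Suc m. H h * ((real h + 1) * z ^ h + (real h - real k) * z ^ Suc h)) / P" for H
        by (simp only: D_def P_def sum_divide_distrib times_divide_eq_right)
      have w_nth: "w q$1 = z ^ Suc m * (dy r x y + 2 * t x y) / P"
        "w q$2 = z ^ Suc m * (dx r x y + 2 * s x y) / P"
        "w q$3 = (z ^ Suc m * ((1 + z) * (dy (dx r) x y + dy s x y + dx t x y))
          + z * (\<Sum>h<Suc m. X h x y * z ^ h)) / P"
        unfolding w_def field3_nth unfold_q by (simp_all only: add_divide_distrib times_divide_eq_left times_divide_eq_right)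
      have e1: "u q$1 = dy R x y / (1 + z) ^ (k + 1) - (\<Sum>h<Suc m. G h x y * D h) + w q$1"
        unfolding u1 unfold_q numerator1 sum_D Pk w_nth
        by (simp only: add_divide_distrib diff_divide_distrib)
      have e2: "u q$2 = (\<Sum>h<Suc m. F h x y * D h) - dx R x y / (1 + z) ^ (k + 1) + w q$2"
        unfolding u2 unfold_q numerator2 sum_D Pk w_nth
        by (simp only: add_divide_distrib diff_divide_distrib)
      have e3: "u q$3 = (\<Sum>h<Suc m. dx (G h) x y * ?g h) - (\<Sum>h<Suc m. dy (F h) x y * ?g h) + w q$3"
      proof -
        define SK where "SK = (\<Sum>h<m. K h x y * z ^ h)"
        define SC where "SC = (\<Sum>h<Suc m. C (Suc h) x y * z ^ h)"
        define T where "T = dy (dx r) x y + dy s x y + dx t x y"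
        have "(\<Sum>h<Suc n. C h x y * z ^ h) = z * SC"
          unfolding sum.lessThan_Suc_shift[of _ n] C0 SC_def sum_distrib_left
          by (simp del: sum.lessThan_Suc add: Suc mult.left_commute)
        moreover have "(dx A2 x y + dy B2 x y) / 2 = K m x y + T"
          using K_top[of x y] by (simp add: T_def)
        ultimately have "u q$3 = (z * SC + z ^ Suc m * (1 + z) * (K m x y + T)) / P"
          unfolding u3 unfold_q A2_def[abs_def] B2_def[abs_def] unfolding Suc by simp
        moreover have "(\<Sum>h<Suc m. dx (G h) x y * ?g h) - (\<Sum>h<Suc m. dy (F h) x y * ?g h) =
            (1 + z) * (z * (SK + K m x y * z ^ m)) / P"
        proof -
          have "SK + K m x y * z ^ m = (\<Sum>h<Suc m. K h x y * z ^ h)"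
            by (simp add: SK_def)
          then show ?thesis
            unfolding sum_subtractf[symmetric] left_diff_distrib[symmetric] K_def[symmetric] Pk[symmetric]
            by (simp only: sum_distrib_left sum_divide_distrib power_Suc times_divide_eq_right mult.left_commute)
        qed
        ultimately show ?thesis
          unfolding w_nth X_sum SK_def[symmetric] SC_def[symmetric] T_def[symmetric]
          by (simp only: add_divide_distrib[symmetric]) (simp add: algebra_simps)
      qed
      show ?thesis
        using d1 d2 d3 e1 e2 e3 unfolding has_curl_def
        by (intro exI conjI) (assumption | rule refl | simp add: vec_eq_iff forall_3)+
    qed
    then show ?thesis
      using W w unfolding k_def Suc by blast
  qed
qed

section \<open>Transfer to the finite pyramid\<close>

theorem lemma4p9:
  fixes k :: nat and v :: "real^3 \<Rightarrow> real^3"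
  assumes "k \<ge> 1" and "v \<in> U2_0 k"
  shows "\<exists>w1 \<in> U1_0_curl k. \<exists>w2 \<in> U2_0_div k.
    \<forall>p \<in> pyramid - {apex}. v p = curl_on pyramid w1 p + w2 p"
proof -
  obtain n where k: "k = Suc n"
    using assms(1) by (cases k) auto
  obtain u where u: "u \<in> U2_inf k" and vu: "\<And>q. q \<in> inf_pyramid \<Longrightarrow> pullback2 phi v q = u q"
    using assms(2) by (auto simp: U2_0_def U2_def push2_def)
  have "zero_flux u"
    using pullback2_zero_flux[OF assms(2)] vu by (simp add: zero_flux_def)
  then obtain W w where W: "W \<in> U1_inf_curl k" and w: "w \<in> U2_inf_div k"
    and eq: "\<And>q. q \<in> inf_pyramid \<Longrightarrow> \<exists>c. has_curl W c q \<and> u q = c + w q"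
    using inf_decomposition[of u n] u unfolding k by blast
  show ?thesis
  proof (intro bexI ballI)
    show "push1_field W \<in> U1_0_curl k"
      unfolding U1_0_curl_eq by (rule push1_field_in_push1[OF W])
    show "push2_field w \<in> U2_0_div k"
      unfolding U2_0_div_eq by (rule push2_field_in_push2[OF w])
    \<comment> \<open>Off the apex \<open>p\<close> is the image of \<open>psi p\<close>, a point of
      the infinite pyramid, where the pointwise decomposition of \<open>u\<close> is
      available.\<close>
    fix p assume p: "p \<in> pyramid - {apex}"
    then have q: "psi p \<in> inf_pyramid"
      using psi_in_inf_pyramid pyramid_height by blast
    obtain c where c: "has_curl W c (psi p)" "u (psi p) = c + w (psi p)"
      using eq[OF q] by blast
    have "v p = push2_field (pullback2 phi v) p"
      using push2_field_pullback2[OF p] ..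
    also have "\<dots> = push2_field (\<lambda>_. c) p + push2_field w p"
      by (rule push2_field_cong_add) (simp add: vu[OF q] c(2))
    also have "push2_field (\<lambda>_. c) p = curl_on pyramid (push1_field W) p"
      using curl_push1_field_has_curl[OF p c(1)] ..
    finally show "v p = curl_on pyramid (push1_field W) p + push2_field w p" .
  qed
qed

end
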